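(* Let $E$ and $F$ be finite sets, let $\mathsf{A}$ be a bimatroid on $E\times F$, and set $N=|E|+|F|$. Let $RR^\updownarrow_k(\mathsf{A})$ be the number of vertical regular rectangles of $\mathsf{A}$ with $k$ columns and $RR^\leftrightarrow_k(\mathsf{A})$ the number of horizontal regular rectangles of $\mathsf{A}$ with $k$ rows. Then both sequences are ultra log-concave: for all $k\ge 1$, \[ \frac{RR_k^\updownarrow(\mathsf{A})^2}{\binom{N}{k}^2}\geq \frac{RR_{k-1}^\updownarrow(\mathsf{A})}{\binom{N}{k-1}}\cdot\frac{RR_{k+1}^\updownarrow(\mathsf{A})}{\binom{N}{k+1}} \quad\text{and}\quad \frac{RR_k^\leftrightarrow(\mathsf{A})^2}{\binom{N}{k}^2}\geq \frac{RR_{k-1}^\leftrightarrow(\mathsf{A})}{\binom{N}{k-1}}\cdot\frac{RR_{k+1}^\leftrightarrow(\mathsf{A})}{\binom{N}{k+1}}. \]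
   Context: For finite sets $E,F$ write $\binom{E}{\ast}\times\binom{F}{\ast}=\bigcup_{d\ge 0}\binom{E}{d}\times\binom{F}{d}$, and $S_{s\leftrightarrow s'}=(S-\{s\})\cup\{s'\}$. A bimatroid $\mathsf{A}$ on $E\times F$ is a subset $\mathcal{R}(\mathsf{A})\subseteq\binom{E}{\ast}\times\binom{F}{\ast}$ (regular minors) such that: (1) $(\emptyset,\emptyset)\in\mathcal{R}(\mathsf{A})$; (2) for all $(I,J),(I',J')\in\mathcal{R}(\mathsf{A})$: (a) for every $i'\in I'-I$, either some $i\in I-I'$ has $(I_{i\leftrightarrow i'},J)\in\mathcal{R}(\mathsf{A})$, or some $j'\in J'-J$ has $(I\cup\{i'\},J\cup\{j'\})\in\mathcal{R}(\mathsf{A})$; (b) for every $j\in J-J'$, either some $j'\in J'-J$ has $(I,J_{j\leftrightarrow j'})\in\mathcal{R}(\mathsf{A})$, or some $i\in I-I'$ has $(I-\{i\},J-\{j\})\in\mathcal{R}(\mathsf{A})$. The relative rank $r_{\mathsf{A}}(S,T)$ for $S\subseteq E$, $T\subseteq F$ is the largest $d$ such that some $(I,J)\in\mathcal{R}(\mathsf{A})$ with $|I|=|J|=d$ has $I\subseteq S$, $J\subseteq T$. A pair $(S,T)$ (a "rectangle" with rows $S$ and columns $T$) is a vertical regular rectangle if $r_{\mathsf{A}}(S,T)=|T|\le |S|$, and a horizontal regular rectangle if $r_{\mathsf{A}}(S,T)=|S|\le|T|$. *)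

theory Defs
  imports Complex_Main
begin

definition same_card_pairs :: "'a set \<Rightarrow> 'b set \<Rightarrow> ('a set \<times> 'b set) set" where
  "same_card_pairs E F = (\<Union>d::nat. {I. I \<subseteq> E \<and> card I = d} \<times> {J. J \<subseteq> F \<and> card J = d})"

definition swap :: "'a set \<Rightarrow> 'a \<Rightarrow> 'a \<Rightarrow> 'a set" where
  "swap S s s' = (S - {s}) \<union> {s'}"

text \<open>A bimatroid on finite sets \<open>E\<close> and \<open>F\<close> is identified with its set \<open>R\<close> of regular minors.\<close>

locale bimatroid =
  fixes E :: "'a set" and F :: "'b set" and R :: "('a set \<times> 'b set) set"
  assumes finite_rows: "finite E"
    and finite_columns: "finite F"
    and minors_subset: "R \<subseteq> same_card_pairs E F"
    and empty_minor: "({}, {}) \<in> R"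
    and row_exchange: "\<And>I J I' J' i'. (I, J) \<in> R \<Longrightarrow> (I', J') \<in> R \<Longrightarrow> i' \<in> I' - I \<Longrightarrow>
        (\<exists>i \<in> I - I'. (swap I i i', J) \<in> R) \<or>
        (\<exists>j' \<in> J' - J. (I \<union> {i'}, J \<union> {j'}) \<in> R)"
    and column_exchange: "\<And>I J I' J' j. (I, J) \<in> R \<Longrightarrow> (I', J') \<in> R \<Longrightarrow> j \<in> J - J' \<Longrightarrow>
        (\<exists>j' \<in> J' - J. (I, swap J j j') \<in> R) \<or>
        (\<exists>i \<in> I - I'. (I - {i}, J - {j}) \<in> R)"

text \<open>The maximum below is over a finite nonempty set whenever \<open>R\<close> is the set of regular
  minors of a bimatroid, since then \<open>R\<close> is finite and contains \<open>({}, {})\<close>.\<close>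

definition relative_rank :: "('a set \<times> 'b set) set \<Rightarrow> 'a set \<Rightarrow> 'b set \<Rightarrow> nat" where
  "relative_rank R S T =
     Max {d. \<exists>I J. (I, J) \<in> R \<and> card I = d \<and> card J = d \<and> I \<subseteq> S \<and> J \<subseteq> T}"

definition vertical_regular :: "('a set \<times> 'b set) set \<Rightarrow> 'a set \<Rightarrow> 'b set \<Rightarrow> bool" where
  "vertical_regular R S T \<longleftrightarrow> relative_rank R S T = card T \<and> card T \<le> card S"

definition horizontal_regular :: "('a set \<times> 'b set) set \<Rightarrow> 'a set \<Rightarrow> 'b set \<Rightarrow> bool" where
  "horizontal_regular R S T \<longleftrightarrow> relative_rank R S T = card S \<and> card S \<le> card T"

definition RR_vertical :: "'a set \<Rightarrow> 'b set \<Rightarrow> ('a set \<times> 'b set) set \<Rightarrow> nat \<Rightarrow> nat" where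
  "RR_vertical E F R k =
     card {(S, T). S \<subseteq> E \<and> T \<subseteq> F \<and> vertical_regular R S T \<and> card T = k}"

definition RR_horizontal :: "'a set \<Rightarrow> 'b set \<Rightarrow> ('a set \<times> 'b set) set \<Rightarrow> nat \<Rightarrow> nat" where
  "RR_horizontal E F R k =
     card {(S, T). S \<subseteq> E \<and> T \<subseteq> F \<and> horizontal_regular R S T \<and> card S = k}"

end

theory Submission
  imports Defs "HOL-Analysis.Analysis"
begin

text \<open>
  The sets \<open>(E - I) \<squnion> J\<close> with \<open>(I, J)\<close> a regular minor are the bases of a matroid on \<open>E \<squnion> F\<close>, and a pair
  \<open>(S, T)\<close> is a vertical regular rectangle iff \<open>(E - S) \<squnion> T\<close> is independent; horizontal rectangles
  correspond in the same way to independent sets of the dual matroid. So one has to show that the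
  numbers of independent sets meeting a fixed set \<open>G\<close> in \<open>k\<close> elements are ultra log-concave. These are
  the coefficients of the homogenised independent set polynomial
  \<open>\<Sum>I. y ^ (N - card I) * (\<Prod>e\<in>I. x e)\<close> after setting \<open>x e\<close> equal to \<open>y\<close> outside \<open>G\<close> and to a second variable on
  \<open>G\<close>. That polynomial is Lorentzian: the Hessian of each of its iterated directional derivatives
  along positive vectors satisfies the reversed Cauchy--Schwarz inequality. This goes by
  induction on the number of vectors, since differentiating by \<open>x e\<close> contracts \<open>e\<close>: the inequality
  for all contractions passes to the matroid itself by a spectral argument.
\<close>

section \<open>Symmetric forms with one positive eigenvalue\<close>

definition bform :: "'i set \<Rightarrow> ('i \<Rightarrow> 'i \<Rightarrow> real) \<Rightarrow> ('i \<Rightarrow> real) \<Rightarrow> ('i \<Rightarrow> real) \<Rightarrow> real" where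
  "bform X a u w = (\<Sum>i\<in>X. u i * (\<Sum>j\<in>X. a i j * w j))"

lemma bform_sym:
  assumes "\<And>i j. i \<in> X \<Longrightarrow> j \<in> X \<Longrightarrow> a i j = a j i"
  shows "bform X a u w = bform X a w u"
proof -
  have "bform X a u w = (\<Sum>i\<in>X. \<Sum>j\<in>X. u i * a i j * w j)"
    by (simp add: bform_def sum_distrib_left mult.assoc)
  also have "\<dots> = (\<Sum>j\<in>X. \<Sum>i\<in>X. u i * a i j * w j)"
    by (rule sum.swap)
  also have "\<dots> = (\<Sum>j\<in>X. \<Sum>i\<in>X. w j * (a j i * u i))"
    by (intro sum.cong refl) (simp add: assms mult_ac)
  finally show ?thesis
    by (simp add: bform_def sum_distrib_left)
qed

lemma bform_add_left: "bform X a (\<lambda>i. u i + t * z i) w = bform X a u w + t * bform X a z w"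
  by (simp add: bform_def algebra_simps sum.distrib sum_distrib_left)

lemma bform_add_right: "bform X a w (\<lambda>i. u i + t * z i) = bform X a w u + t * bform X a w z"
  by (simp add: bform_def algebra_simps sum.distrib sum_distrib_left)

lemma bform_scale: "bform X a (\<lambda>i. t * u i) (\<lambda>i. t * u i) = t\<^sup>2 * bform X a u u"
  by (simp add: bform_def algebra_simps sum_distrib_left power2_eq_square)

lemma bform_square_add:
  assumes "\<And>i j. i \<in> X \<Longrightarrow> j \<in> X \<Longrightarrow> a i j = a j i"
  shows "bform X a (\<lambda>i. u i + t * z i) (\<lambda>i. u i + t * z i)
    = bform X a u u + 2 * t * bform X a u z + t\<^sup>2 * bform X a z z"
  by (simp add: bform_add_left bform_add_right bform_sym[OF assms, where u = z and w = u] power2_eq_square algebra_simps)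

lemma bform_cong:
  assumes "\<And>i. i \<in> X \<Longrightarrow> u i = u' i" "\<And>i. i \<in> X \<Longrightarrow> w i = w' i"
  shows "bform X a u w = bform X a u' w'"
  using assms by (simp add: bform_def)

lemma bform_diag:
  assumes "finite X"
  shows "bform X (\<lambda>i j. if i = j then d i else 0) u w = (\<Sum>i\<in>X. d i * u i * w i)"
proof -
  have "(\<Sum>j\<in>X. (if i = j then d i else 0) * w j) = d i * w i" if "i \<in> X" for i
    using sum.delta'[OF assms, of i "\<lambda>j. d i * w j"] that by (simp add: if_distrib[of "\<lambda>c. c * _"] cong: if_cong)
  then show ?thesis by (simp add: bform_def mult_ac)
qed

text \<open>The first-order condition at a maximum; below it turns a maximiser of the Rayleigh
  quotient into an eigenvector.\<close>

lemma quadratic_nonpos_imp_linear_zero: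
  fixes p q :: real
  assumes "\<And>t. 2 * t * p + t\<^sup>2 * q \<le> 0"
  shows "p = 0"
proof (rule ccontr)
  assume "p \<noteq> 0"
  \<comment> \<open>A step in the direction of \<open>p\<close>, short enough that the linear term
    \<open>2 * s * p\<close> dominates the quadratic one.\<close>
  define s where "s = p / (\<bar>q\<bar> + 1)"
  have sq: "s * (\<bar>q\<bar> + 1) = p" by (simp add: s_def add_nonneg_eq_0_iff)
  have "s \<noteq> 0" using \<open>p \<noteq> 0\<close> sq by auto
  have "2 * s * p + s\<^sup>2 * q = s\<^sup>2 * (2 * (\<bar>q\<bar> + 1) + q)"
    unfolding sq[symmetric] by (simp add: power2_eq_square algebra_simps)
  moreover have "\<dots> > 0" using \<open>s \<noteq> 0\<close> by (intro mult_pos_pos) auto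
  ultimately show False using assms[of s] by simp
qed

text \<open>The bound against one \<open>x\<close> of positive value makes the form nonpositive on
  the complement of \<open>x\<close>. A combination of \<open>u\<close> and \<open>w\<close>
  orthogonal to \<open>x\<close> is then nonpositive, so the form is not positive definite on their
  span, and \<open>w\<close> can take over the role of \<open>x\<close>.\<close>

lemma reverse_Cauchy_Schwarz_transfer:
  assumes sym: "\<And>i j. i \<in> X \<Longrightarrow> j \<in> X \<Longrightarrow> a i j = a j i"
    and pos: "bform X a x x > 0"
    and rcs: "\<And>u. bform X a u u * bform X a x x \<le> (bform X a u x)\<^sup>2"
    and w: "bform X a w w \<ge> 0"
  shows "bform X a u u * bform X a w w \<le> (bform X a u w)\<^sup>2"
proof (cases "bform X a u u > 0 \<and> bform X a w w > 0")
  case False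
  then have "bform X a u u * bform X a w w \<le> 0"
    using w by (auto simp: mult_le_0_iff)
  then show ?thesis by (meson order_trans zero_le_power2)
next
  case True
  \<comment> \<open>If \<open>w\<close> were orthogonal to \<open>x\<close>, its own value could not
    be positive; so \<open>t\<close> below can cancel the \<open>x\<close>-component of
    \<open>u\<close>.\<close>
  have "(bform X a w x)\<^sup>2 > 0"
    using rcs[of w] True pos by (smt (verit) mult_pos_pos)
  then have nz: "bform X a w x \<noteq> 0" by auto
  define t where "t = - bform X a u x / bform X a w x"
  define z where "z = (\<lambda>i. u i + t * w i)"
  have "bform X a z x = 0" using nz unfolding z_def bform_add_left by (simp add: t_def)
  then have "bform X a z z * bform X a x x \<le> 0" using rcs[of z] by simp
  then have "bform X a z z \<le> 0" using pos by (simp add: mult_le_0_iff)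
  then have q: "bform X a u u + 2 * t * bform X a u w + t\<^sup>2 * bform X a w w \<le> 0"
    using bform_square_add[where X = X and a = a and u = u and t = t and z = w, OF sym]
    unfolding z_def by simp
  let ?p = "bform X a u u" and ?q = "bform X a w w" and ?r = "bform X a u w"
  have "?q * (?p + 2 * t * ?r + t\<^sup>2 * ?q) \<le> 0"
    using q True by (simp add: mult_le_0_iff)
  moreover have "?q * (?p + 2 * t * ?r + t\<^sup>2 * ?q) = (?q * t + ?r)\<^sup>2 + (?p * ?q - ?r\<^sup>2)"
    by (simp add: power2_eq_square algebra_simps)
  ultimately show ?thesis
    by (smt (verit) zero_le_power2)
qed

text \<open>The domain for maximising the Rayleigh quotient: the unit sphere of a diagonal form
  within the complement of \<open>x\<close>. Its functions vanish outside \<open>X\<close>, so it is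
  closed in a product of compact intervals and Tychonoff's theorem applies.\<close>

lemma compact_ellipsoid_section:
  fixes x d :: "'i \<Rightarrow> real"
  assumes fin: "finite X" and d: "\<And>i. i \<in> X \<Longrightarrow> d i > 0"
  shows "compact {w :: 'i \<Rightarrow> real. (\<forall>i. i \<notin> X \<longrightarrow> w i = 0) \<and>
     (\<Sum>i\<in>X. d i * w i * w i) = 1 \<and> (\<Sum>i\<in>X. d i * w i * x i) = 0}" (is "compact ?K")
proof -
  define C where "C i = (if i \<in> X then {- (1 / sqrt (d i)) .. 1 / sqrt (d i)} else {0})" for i
  have "compactin (product_topology (\<lambda>i::'i. euclidean :: real topology) UNIV) (PiE UNIV C)"
    unfolding compactin_PiE by (auto simp: C_def)
  then have cC: "compact (PiE UNIV C)"
    by (simp add: euclidean_product_topology)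
  define L where "L = {w :: 'i \<Rightarrow> real. (\<Sum>i\<in>X. d i * w i * w i) = 1} \<inter>
     {w. (\<Sum>i\<in>X. d i * w i * x i) = 0}"
  have "closed L"
    unfolding L_def
    by (intro closed_Int closed_Collect_eq continuous_intros continuous_on_product_coordinates)
  moreover have "?K = PiE UNIV C \<inter> L"
  proof (intro equalityI subsetI)
    fix w assume w: "w \<in> ?K"
    have "w i \<in> C i" for i
    proof (cases "i \<in> X")
      case True
      have "d i * w i * w i \<le> (\<Sum>i\<in>X. d i * w i * w i)"
        using fin True d by (intro member_le_sum) (auto simp: mult.assoc less_imp_le)
      then have "(sqrt (d i) * w i)\<^sup>2 \<le> 1"
        using w d[OF True] unfolding power_mult_distrib by (simp add: power2_eq_square mult.assoc)
      then have "\<bar>sqrt (d i) * w i\<bar> \<le> 1" by (simp add: abs_square_le_1)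
      then show ?thesis
        using True d[OF True] by (auto simp: C_def abs_le_iff field_simps)
    next
      case False then show ?thesis using w by (simp add: C_def)
    qed
    then show "w \<in> PiE UNIV C \<inter> L" using w by (auto simp: L_def)
  next
    fix w assume w: "w \<in> PiE UNIV C \<inter> L"
    then have "w i \<in> C i" for i by (auto simp: PiE_def)
    then have "\<forall>i. i \<notin> X \<longrightarrow> w i = 0" by (metis C_def singletonD)
    with w show "w \<in> ?K" by (auto simp: L_def)
  qed
  ultimately show ?thesis using compact_Int_closed[OF cC] by simp
qed

text \<open>
  Let \<open>D\<close> be the diagonal form with entries \<open>(a x)\<^sub>i / x\<^sub>i\<close>. The last hypothesis says that
  \<open>P = D\<inverse> a\<close>, which is self-adjoint for \<open>D\<close>, satisfies \<open>P \<le> P\<^sup>2\<close>, so no eigenvalue of \<open>P\<close>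
  lies strictly between 0 and 1. By Perron--Frobenius the largest one is 1, and it is simple
  (eigenvector \<open>x\<close>, with \<open>h\<close> providing irreducibility). Hence the form is negative semidefinite
  on the complement of \<open>x\<close>. Only an eigenvector maximising the Rayleigh quotient there is needed.
\<close>

lemma trickle_down:
  fixes a :: "'i \<Rightarrow> 'i \<Rightarrow> real"
  assumes fin: "finite X"
    and sym: "\<And>i j. i \<in> X \<Longrightarrow> j \<in> X \<Longrightarrow> a i j = a j i"
    and nonneg: "\<And>i j. i \<in> X \<Longrightarrow> j \<in> X \<Longrightarrow> a i j \<ge> 0"
    and xpos: "\<And>i. i \<in> X \<Longrightarrow> x i > 0"
    and h: "h \<in> X" "\<And>j. j \<in> X \<Longrightarrow> a h j > 0"
    and le: "\<And>u. bform X a u u \<le> (\<Sum>i\<in>X. x i * ((\<Sum>j\<in>X. a i j * u j)\<^sup>2 / (\<Sum>j\<in>X. a i j * x j)))"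
  shows "bform X a u u * bform X a x x \<le> (bform X a u x)\<^sup>2" and "bform X a x x > 0"
proof -
  define row where "row u i = (\<Sum>j\<in>X. a i j * u j)" for u i
  have rowpos: "row x i > 0" if "i \<in> X" for i
  proof -
    have "a i h * x h \<le> row x i"
      unfolding row_def using that h(1) fin nonneg xpos
      by (intro member_le_sum) (auto intro!: mult_nonneg_nonneg intro: less_imp_le)
    moreover have "a i h * x h > 0" using h that sym xpos by (metis mult_pos_pos)
    ultimately show ?thesis by linarith
  qed
  \<comment> \<open>Chosen so that the diagonal form and \<open>a\<close> agree when paired with
    \<open>x\<close>, which makes \<open>x\<close> an eigenvector for eigenvalue 1.\<close>
  define d where "d i = row x i / x i" for i
  have dpos: "d i > 0" if "i \<in> X" for i using rowpos xpos that by (simp add: d_def)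
  have dx: "d i * x i = row x i" if "i \<in> X" for i
    using xpos[OF that] by (simp add: d_def)
  define D where "D = bform X (\<lambda>i j. if i = j then d i else 0)"
  have D: "D u w = (\<Sum>i\<in>X. d i * u i * w i)" for u w
    unfolding D_def by (rule bform_diag[OF fin])
  have brow: "bform X a u w = (\<Sum>i\<in>X. row u i * w i)" for u w
    using bform_sym[OF sym, where u = u and w = w] by (simp add: bform_def row_def mult.commute)
  have bx: "bform X a u x = D u x" for u
    unfolding D bform_def by (intro sum.cong refl) (simp add: dx[symmetric] row_def[symmetric])
  show xx: "bform X a x x > 0"
    unfolding brow using fin h(1) rowpos xpos by (intro sum_pos) auto
  have D0: "u i = 0" if "D u u = 0" "i \<in> X" for u i
  proof -
    have "\<forall>i\<in>X. d i * u i * u i = 0"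
      using that(1) fin dpos unfolding D
      by (subst (asm) sum_nonneg_eq_0_iff) (auto simp: mult.assoc less_imp_le)
    then show ?thesis using dpos[OF that(2)] that(2) by auto
  qed
  have Dnn: "D u u \<ge> 0" for u
    unfolding D using dpos by (intro sum_nonneg) (auto simp: mult.assoc less_imp_le)
  \<comment> \<open>A graph Laplacian in the ratios \<open>u i / x i\<close> with edge weights
    \<open>a i j * x i * x j\<close>: it bounds the eigenvalues by 1, and equality forces the ratios
    to agree along edges.\<close>
  have perron: "D u u - bform X a u u =
      (1/2) * (\<Sum>i\<in>X. \<Sum>j\<in>X. a i j * x i * x j * (u i / x i - u j / x j)\<^sup>2)" for u
  proof -
    have t: "a i j * x i * x j * (u i / x i - u j / x j)\<^sup>2 =
        u i * u i / x i * (a i j * x j) + u j * u j / x j * (a j i * x i) - 2 * (u i * (a i j * u j))"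
      if "i \<in> X" "j \<in> X" for i j
    proof -
      define p where "p = u i / x i"
      define q where "q = u j / x j"
      have "u i = p * x i" "u j = q * x j" using xpos[OF that(1)] xpos[OF that(2)]
        by (simp_all add: p_def q_def)
      then show ?thesis using xpos[OF that(1)] xpos[OF that(2)] sym[OF that]
        by (simp add: power2_eq_square algebra_simps)
    qed
    have s1: "(\<Sum>i\<in>X. \<Sum>j\<in>X. u i * u i / x i * (a i j * x j)) = D u u"
      unfolding D
      by (intro sum.cong refl) (simp add: sum_distrib_left[symmetric] sum_divide_distrib[symmetric] d_def row_def mult_ac)
    have s2: "(\<Sum>i\<in>X. \<Sum>j\<in>X. u j * u j / x j * (a j i * x i)) = D u u"
      by (subst sum.swap) (rule s1)
    have s3: "(\<Sum>i\<in>X. \<Sum>j\<in>X. 2 * (u i * (a i j * u j))) = 2 * bform X a u u"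
      by (simp add: bform_def sum_distrib_left)
    have "(\<Sum>i\<in>X. \<Sum>j\<in>X. a i j * x i * x j * (u i / x i - u j / x j)\<^sup>2) =
        (\<Sum>i\<in>X. \<Sum>j\<in>X. u i * u i / x i * (a i j * x j) + u j * u j / x j * (a j i * x i) - 2 * (u i * (a i j * u j)))"
      by (intro sum.cong refl t)
    also have "\<dots> = D u u + D u u - 2 * bform X a u u"
      by (simp only: sum_subtractf sum.distrib s1 s2 s3)
    finally show ?thesis by simp
  qed
  have tnn: "a i j * x i * x j * (u i / x i - u j / x j)\<^sup>2 \<ge> 0" if "i \<in> X" "j \<in> X" for i j u
    using nonneg[OF that] xpos[OF that(1)] xpos[OF that(2)] by simp
  have perron_le: "bform X a u u \<le> D u u" for u
  proof -
    have "(\<Sum>i\<in>X. \<Sum>j\<in>X. a i j * x i * x j * (u i / x i - u j / x j)\<^sup>2) \<ge> 0"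
      by (intro sum_nonneg tnn)
    then show ?thesis using perron[of u] by linarith
  qed
  have perron_eq: "u j = u h / x h * x j" if eq: "bform X a u u = D u u" and j: "j \<in> X" for u j
  proof -
    have "(\<Sum>i\<in>X. \<Sum>j\<in>X. a i j * x i * x j * (u i / x i - u j / x j)\<^sup>2) = 0"
      using perron[of u] eq by simp
    then have "(\<Sum>j\<in>X. a h j * x h * x j * (u h / x h - u j / x j)\<^sup>2) = 0"
      using fin h(1) by (subst (asm) sum_nonneg_eq_0_iff) (auto intro!: sum_nonneg tnn)
    then have "a h j * x h * x j * (u h / x h - u j / x j)\<^sup>2 = 0"
      using fin h(1) j by (subst (asm) sum_nonneg_eq_0_iff) (auto intro!: tnn)
    then show ?thesis using h(2)[OF j] xpos[OF h(1)] xpos[OF j] by (auto simp: field_simps)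
  qed
  have neg: "bform X a u u \<le> 0" if ux: "D u x = 0" for u
  proof (rule ccontr)
    assume "\<not> bform X a u u \<le> 0"
    then have upos: "bform X a u u > 0" by simp
    define K where "K = {w :: 'i \<Rightarrow> real. (\<forall>i. i \<notin> X \<longrightarrow> w i = 0) \<and>
      (\<Sum>i\<in>X. d i * w i * w i) = 1 \<and> (\<Sum>i\<in>X. d i * w i * x i) = 0}"
    have cK: "compact K" unfolding K_def by (rule compact_ellipsoid_section[OF fin dpos])
    have inK: "\<exists>w'\<in>K. bform X a w w = D w w * bform X a w' w'"
      if "D w x = 0" "D w w > 0" for w
    proof -
      define s where "s = 1 / sqrt (D w w)"
      have s: "s\<^sup>2 * D w w = 1" using that(2) by (simp add: s_def power_divide)
      define w' where "w' i = (if i \<in> X then s * w i else 0)" for i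
      have c: "bform X b w' w' = s\<^sup>2 * bform X b w w" for b
        unfolding bform_scale[symmetric] by (rule bform_cong) (auto simp: w'_def)
      have "D w' w' = 1" using c s unfolding D_def by simp
      moreover have "D w' x = s * D w x"
        unfolding D by (auto simp: w'_def sum_distrib_left intro!: sum.cong)
      ultimately have "w' \<in> K" using that(1) by (auto simp: K_def D[symmetric] w'_def)
      moreover have "bform X a w w = D w w * bform X a w' w'"
        unfolding c using s by (simp add: algebra_simps)
      ultimately show ?thesis by blast
    qed
    have coord: "continuous_on K (\<lambda>w. w i)" for i
      by (rule continuous_on_subset[OF continuous_on_product_coordinates subset_UNIV])
    have cont: "continuous_on K (\<lambda>w. bform X a w w)"
      unfolding bform_def by (intro continuous_on_sum continuous_on_mult continuous_on_const coord)
    have "D u u > 0" using upos perron_le[of u] by linarith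
    from inK[OF ux this] have "K \<noteq> {}" by blast
    from continuous_attains_sup[OF cK this cont]
    obtain z where z: "z \<in> K" and zmax: "\<And>w. w \<in> K \<Longrightarrow> bform X a w w \<le> bform X a z z"
      by blast
    have zz: "D z z = 1" and zx: "D z x = 0" using z unfolding K_def D by simp_all
    define l where "l = bform X a z z"
    have lpos: "l > 0"
    proof -
      obtain w' where "w' \<in> K" "bform X a u u = D u u * bform X a w' w'"
        using inK[OF ux \<open>D u u > 0\<close>] by blast
      then show ?thesis using zmax[of w'] upos \<open>D u u > 0\<close> by (simp add: l_def zero_less_mult_iff)
    qed
    have rayleigh: "bform X a w w \<le> l * D w w" if wx: "D w x = 0" for w
    proof (cases "D w w = 0")
      case True
      then show ?thesis using perron_le[of w] by simp
    next
      case False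
      then have p: "D w w > 0" using Dnn[of w] by simp
      then obtain w' where "w' \<in> K" "bform X a w w = D w w * bform X a w' w'"
        using inK[OF wx p] by blast
      then show ?thesis using zmax[of w'] p by (simp add: l_def mult.commute)
    qed
    have asq: "bform X a (\<lambda>i. z i + t * g i) (\<lambda>i. z i + t * g i) =
        bform X a z z + 2 * t * bform X a z g + t\<^sup>2 * bform X a g g" for t g
      by (rule bform_square_add[OF sym])
    have Dadd: "D (\<lambda>i. z i + t * g i) (\<lambda>i. z i + t * g i) =
        D z z + 2 * t * D z g + t\<^sup>2 * D g g" for t g
      unfolding D_def by (rule bform_square_add) auto
    have crit: "bform X a z g = l * D z g" if "D g x = 0" for g
    proof -
      have "2 * t * (bform X a z g - l * D z g) + t\<^sup>2 * (bform X a g g - l * D g g) \<le> 0" for t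
      proof -
        have "D (\<lambda>i. z i + t * g i) x = 0"
          using zx that unfolding D_def by (simp add: bform_add_left)
        from rayleigh[OF this]
        have "bform X a z z + 2 * t * bform X a z g + t\<^sup>2 * bform X a g g
          \<le> l * (D z z + 2 * t * D z g + t\<^sup>2 * D g g)"
          unfolding Dadd asq .
        then show ?thesis by (simp add: zz l_def[symmetric] algebra_simps)
      qed
      then show ?thesis using quadratic_nonpos_imp_linear_zero by fastforce
    qed
    \<comment> \<open>The residual of the eigenvalue equation at \<open>z\<close>. It is orthogonal
      to \<open>x\<close>, so it can serve as its own test direction in \<open>crit\<close>, which
      makes its norm zero.\<close>
    define g where "g i = row z i / d i + (- l) * z i" for i
    have gleft: "D g w = D (\<lambda>i. row z i / d i) w + (- l) * D z w" for w
      unfolding g_def D_def bform_add_left ..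
    have gx: "D g x = 0"
    proof -
      have "D g x = D (\<lambda>i. row z i / d i) x + (- l) * D z x"
        by (rule gleft)
      also have "D (\<lambda>i. row z i / d i) x = bform X a z x"
        unfolding D brow using dpos by (intro sum.cong refl) (simp add: less_imp_neq[symmetric])
      finally show ?thesis by (simp add: bx zx)
    qed
    have "D g g = bform X a z g - l * D z g"
    proof -
      have "D g g = D (\<lambda>i. row z i / d i) g + (- l) * D z g"
        by (rule gleft)
      also have "D (\<lambda>i. row z i / d i) g = bform X a z g"
        unfolding D brow using dpos by (intro sum.cong refl) (simp add: less_imp_neq[symmetric])
      finally show ?thesis by simp
    qed
    then have "D g g = 0" using crit[OF gx] by simp
    then have eig: "row z i = l * (d i * z i)" if "i \<in> X" for i
      using D0[of g i] that dpos[OF that] by (simp add: g_def field_simps)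
    \<comment> \<open>At an eigenvector, hypothesis \<open>le\<close> reads
      \<open>l \<le> l * l\<close>, so the positive \<open>l\<close> is at least 1. Equality in the
      Perron bound then makes \<open>z\<close> a multiple of \<open>x\<close>, although it is
      orthogonal to \<open>x\<close>.\<close>
    have "l \<le> (\<Sum>i\<in>X. x i * ((row z i)\<^sup>2 / row x i))"
      using le[of z] by (simp add: l_def row_def)
    also have "\<dots> = (\<Sum>i\<in>X. l\<^sup>2 * (d i * z i * z i))"
    proof (intro sum.cong refl)
      fix i assume i: "i \<in> X"
      show "x i * ((row z i)\<^sup>2 / row x i) = l\<^sup>2 * (d i * z i * z i)"
        using dpos[OF i] xpos[OF i]
        by (simp add: eig[OF i] dx[OF i, symmetric] power2_eq_square)
    qed
    also have "\<dots> = l\<^sup>2 * D z z" by (simp add: D sum_distrib_left)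
    finally have "l \<le> l * l" using zz by (simp add: power2_eq_square)
    then have "1 \<le> l" using lpos by simp
    then have "bform X a z z = D z z" using perron_le[of z] zz by (simp add: l_def)
    then have propto: "z j = z h / x h * x j" if "j \<in> X" for j using perron_eq that by blast
    have "D z x = z h / x h * D x x"
      unfolding D sum_distrib_left using propto by (intro sum.cong refl) simp
    moreover have "D x x > 0" using xx bx by metis
    ultimately have "z h / x h = 0" using zx by simp
    then have "z j = 0" if "j \<in> X" for j using propto[OF that] by (metis mult_zero_left)
    then have "D z z = 0" unfolding D by (intro sum.neutral) simp
    then show False using zz by simp
  qed
  show "bform X a u u * bform X a x x \<le> (bform X a u x)\<^sup>2"
  proof -
    define t where "t = - bform X a u x / bform X a x x"
    have tx: "t * bform X a x x = - bform X a u x" using xx by (simp add: t_def)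
    have "bform X a (\<lambda>i. u i + t * x i) x = 0" using tx by (simp add: bform_add_left)
    then have "bform X a (\<lambda>i. u i + t * x i) (\<lambda>i. u i + t * x i) \<le> 0" by (intro neg) (simp add: bx[symmetric])
    then have "bform X a u u + 2 * t * bform X a u x + t * (t * bform X a x x) \<le> 0"
      using bform_square_add[where X = X and a = a and u = u and t = t and z = x, OF sym]
      by (simp add: power2_eq_square mult.assoc)
    then have "bform X a u u + t * bform X a u x \<le> 0" unfolding tx by simp
    then have "(bform X a u u + t * bform X a u x) * bform X a x x \<le> 0"
      using xx by (simp add: mult_le_0_iff)
    then have "bform X a u u * bform X a x x + (t * bform X a x x) * bform X a u x \<le> 0"
      by (simp add: algebra_simps)
    then show ?thesis unfolding tx by (simp add: power2_eq_square)
  qed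
qed

section \<open>Derivatives of the independent set polynomial\<close>

locale matroid =
  fixes V :: "'e set" and indep :: "'e set \<Rightarrow> bool"
  assumes finite_ground: "finite V"
    and indep_subset_ground: "indep S \<Longrightarrow> S \<subseteq> V"
    and indep_empty: "indep {}"
    and indep_mono: "indep S \<Longrightarrow> S' \<subseteq> S \<Longrightarrow> indep S'"
    and augment: "indep S \<Longrightarrow> indep S' \<Longrightarrow> card S < card S' \<Longrightarrow> \<exists>e \<in> S' - S. indep (insert e S)"
begin

text \<open>The variables in which the contraction by \<open>S\<close> has a nonzero derivative:
  \<open>None\<close> stands for \<open>y\<close>, \<open>Some e\<close> for a non-loop
  \<open>e\<close>. Differentiating by \<open>y\<close> leaves the set alone.\<close>

definition steps :: "'e set \<Rightarrow> 'e option set" where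
  "steps S = insert None (Some ` {e \<in> V - S. indep (insert e S)})"

definition step :: "'e set \<Rightarrow> 'e option \<Rightarrow> 'e set" where
  "step S i = (case i of None \<Rightarrow> S | Some e \<Rightarrow> insert e S)"

text \<open>
  If \<open>card S + length vs = N\<close>, then \<open>dirderiv N S vs\<close> is the derivative \<open>D\<^sub>v\<^sub>s \<partial>\<^sub>S\<close> of
  \<open>\<Sum>I indep. y ^ (N - card I) * (\<Prod>e\<in>I. x e)\<close>, the coordinate \<open>None\<close> of a vector being its
  \<open>y\<close>-direction. For shorter \<open>vs\<close>, the missing \<open>N - card S - length vs\<close> derivatives are by \<open>y\<close>;
  they produce the factorial in the base case.
\<close>

fun dirderiv :: "nat \<Rightarrow> 'e set \<Rightarrow> ('e option \<Rightarrow> real) list \<Rightarrow> real" where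
  "dirderiv N S [] = fact (N - card S)"
| "dirderiv N S (v # vs) = (\<Sum>i\<in>steps S. v i * dirderiv N (step S i) vs)"

text \<open>The conditional gives zero for an element repeated or parallel to the first: the
  polynomial is multiaffine in the \<open>x e\<close> and has no monomials with dependent
  support.\<close>

definition hess :: "nat \<Rightarrow> 'e set \<Rightarrow> ('e option \<Rightarrow> real) list \<Rightarrow> 'e option \<Rightarrow> 'e option \<Rightarrow> real" where
  "hess N S vs i j = (if j \<in> steps (step S i) then dirderiv N (step (step S i) j) vs else 0)"

section \<open>Symmetry, commutation and positivity of the derivatives\<close>

lemma finite_steps: "finite (steps S)"
  using finite_ground by (simp add: steps_def)

lemma None_in_steps: "None \<in> steps S"
  by (simp add: steps_def)

lemma Some_in_steps: "Some e \<in> steps S \<longleftrightarrow> e \<in> V \<and> e \<notin> S \<and> indep (insert e S)"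
  by (auto simp: steps_def)

lemma indep_step: "indep S \<Longrightarrow> i \<in> steps S \<Longrightarrow> indep (step S i)"
  by (auto simp: steps_def step_def)

lemma finite_indep: "indep S \<Longrightarrow> finite S"
  using finite_ground indep_subset_ground finite_subset by blast

lemma card_step_le: "card (step S i) \<le> Suc (card S)"
  by (cases i) (auto simp: step_def card_insert_le_m1 intro: card_insert_le_m1)

lemma steps_step_subset: "steps (step S i) \<subseteq> steps S"
proof
  fix j assume j: "j \<in> steps (step S i)"
  show "j \<in> steps S"
  proof (cases j)
    case None then show ?thesis by (simp add: None_in_steps)
  next
    case (Some f)
    have "S \<subseteq> step S i" by (cases i) (auto simp: step_def)
    with j Some show ?thesis
      by (auto simp: Some_in_steps intro: indep_mono insert_mono)
  qed
qed

lemma step_commute: "step (step S i) j = step (step S j) i"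
  by (cases i; cases j) (auto simp: step_def)

lemma steps_exchange:
  assumes "i \<in> steps S" "j \<in> steps (step S i)"
  shows "i \<in> steps (step S j)"
  using assms
  by (cases i; cases j) (auto simp: step_def steps_def insert_commute)

lemma hess_sym:
  assumes "i \<in> steps S" "j \<in> steps S"
  shows "hess N S vs i j = hess N S vs j i"
  using steps_exchange[OF assms(1), of j] steps_exchange[OF assms(2), of i]
  by (auto simp: hess_def step_commute[of S i j])

text \<open>Rows of the Hessian are thereby derivatives of contractions, which is how the
  inequalities for contractions enter the induction.\<close>

lemma sum_hess:
  assumes "i \<in> steps S"
  shows "(\<Sum>j\<in>steps S. hess N S vs i j * w j) = dirderiv N (step S i) (w # vs)"
proof -
  have "(\<Sum>j\<in>steps S. hess N S vs i j * w j) = (\<Sum>j\<in>steps (step S i). hess N S vs i j * w j)"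
    using steps_step_subset by (intro sum.mono_neutral_right finite_steps) (auto simp: hess_def)
  also have "\<dots> = dirderiv N (step S i) (w # vs)"
    by (simp add: hess_def mult.commute)
  finally show ?thesis .
qed

lemma bform_hess: "bform (steps S) (hess N S vs) u w = dirderiv N S (u # w # vs)"
  unfolding bform_def dirderiv.simps(2)[of N S u] by (intro sum.cong refl) (simp add: sum_hess)

lemma dirderiv_swap: "dirderiv N S (u # w # vs) = dirderiv N S (w # u # vs)"
  unfolding bform_hess[symmetric] by (rule bform_sym) (rule hess_sym)

lemma dirderiv_Cons_cong:
  "(\<And>S. dirderiv N S vs = dirderiv N S ws) \<Longrightarrow> dirderiv N S (v # vs) = dirderiv N S (v # ws)"
  by simp

lemma dirderiv_move: "dirderiv N S (us @ v # vs) = dirderiv N S (v # us @ vs)"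
proof (induction us arbitrary: S)
  case (Cons u us)
  have "dirderiv N S (u # us @ v # vs) = dirderiv N S (u # v # us @ vs)"
    by (rule dirderiv_Cons_cong) (rule Cons.IH)
  then show ?case by (simp only: append_Cons dirderiv_swap[of N S u v])
qed simp

lemma dirderiv_pos:
  assumes "\<forall>v\<in>set vs. \<forall>i. v i > 0"
  shows "dirderiv N S vs > 0"
  using assms
proof (induction vs arbitrary: S)
  case (Cons v vs)
  then show ?case
    by (auto intro!: sum_pos finite_steps mult_pos_pos simp: ex_in_conv[symmetric] intro: None_in_steps)
qed simp

lemma dirderiv_nonneg:
  assumes "\<forall>v\<in>set vs. \<forall>i. v i \<ge> 0"
  shows "dirderiv N S vs \<ge> 0"
  using assms
proof (induction vs arbitrary: S)
  case (Cons v vs)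
  then show ?case by (auto intro!: sum_nonneg mult_nonneg_nonneg)
qed simp

text \<open>
  After eliminating the variable \<open>y\<close>, the inequality is Cauchy--Schwarz for the sums over the
  parallel classes of the contraction by \<open>S\<close>, of which there are at most \<open>N - card S\<close>.
\<close>

lemma hodge_riemann_quadratic:
  assumes S: "indep S" and N: "card S + 2 \<le> N" "card V \<le> N"
    and w: "dirderiv N S [w, w] \<ge> 0"
  shows "dirderiv N S [u, u] * dirderiv N S [w, w] \<le> (dirderiv N S [u, w])\<^sup>2"
proof -
  define P where "P = {e \<in> V - S. indep (insert e S)}"
  \<comment> \<open>At \<open>S\<close> there remain \<open>n + 2\<close> derivatives, so the
    constants below are the factorials of \<open>n + 2\<close>, \<open>n + 1\<close> and
    \<open>n\<close>.\<close>
  define n where "n = N - card S - 2"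
  have finP: "finite P" using finite_ground by (simp add: P_def)
  have stS: "steps S = insert None (Some ` P)" by (simp add: steps_def P_def)
  have cS: "N - card S = Suc (Suc n)" using N by (simp add: n_def)
  have cS1: "N - card (insert e S) = Suc n" if "e \<in> P" for e
    using that finite_indep[OF S] N by (simp add: P_def n_def)
  \<comment> \<open>The pure \<open>y\<close>-direction: the inequality is proved with
    \<open>e0\<close> in place of \<open>w\<close> and then transferred.\<close>
  define e0 :: "'e option \<Rightarrow> real" where "e0 i = (if i = None then 1 else 0)" for i
  \<comment> \<open>Parallelism in the contraction by \<open>S\<close>; \<open>e = f\<close> is
    listed separately because a single non-loop is independent.\<close>
  define par where "par e f \<longleftrightarrow> e = f \<or> \<not> indep (insert e (insert f S))" for e f
  have par_sym: "par e f \<Longrightarrow> par f e" for e f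
    by (auto simp: par_def insert_commute)
  have par_trans: "par e g" if efg: "e \<in> P" "f \<in> P" "g \<in> P" and p: "par e f" "par f g" for e f g
  proof (rule ccontr)
    assume "\<not> par e g"
    then have "e \<noteq> g" and i: "indep (insert e (insert g S))" by (auto simp: par_def)
    then have "card (insert f S) < card (insert e (insert g S))"
      using efg finite_indep[OF S] by (simp add: P_def)
    with augment[OF _ i, of "insert f S"] efg(2)
    obtain x where x: "x \<in> insert e (insert g S) - insert f S" "indep (insert x (insert f S))"
      by (auto simp: P_def)
    then show False using p by (auto simp: par_def insert_commute)
  qed
  define cls where "cls e = {f \<in> P. par e f}" for e
  have cls_eq: "cls e = cls f \<longleftrightarrow> par e f" if "e \<in> P" "f \<in> P" for e f
  proof
    assume "cls e = cls f"
    moreover have "f \<in> cls f" using that by (simp add: cls_def par_def)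
    ultimately show "par e f" by (auto simp: cls_def)
  next
    assume "par e f"
    then show "cls e = cls f"
      using that par_trans par_sym unfolding cls_def by blast
  qed
  have t1: "dirderiv N (insert e S) [v] = fact (Suc n) * v None +
      fact n * (\<Sum>f\<in>{f\<in>P. \<not> par e f}. v (Some f))" if e: "e \<in> P" for e v
  proof -
    have st: "steps (insert e S) = insert None (Some ` {f\<in>P. \<not> par e f})"
      using e by (auto simp: steps_def P_def par_def insert_commute image_iff intro: indep_mono)
    have c: "N - card (insert f (insert e S)) = n" if "f \<in> {f\<in>P. \<not> par e f}" for f
      using that e finite_indep[OF S] N by (auto simp: P_def par_def n_def)
    have "dirderiv N (insert e S) [v] = v None * fact (Suc n) +
      (\<Sum>f\<in>{f\<in>P. \<not> par e f}. v (Some f) * fact (N - card (insert f (insert e S))))"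
      using finP by (simp add: st sum.reindex step_def cS1[OF e] del: fact_Suc)
    also have "(\<Sum>f\<in>{f\<in>P. \<not> par e f}. v (Some f) * fact (N - card (insert f (insert e S))))
       = (\<Sum>f\<in>{f\<in>P. \<not> par e f}. fact n * v (Some f))"
      by (intro sum.cong refl) (simp only: c mult.commute)
    finally show ?thesis by (simp add: sum_distrib_left mult.commute)
  qed
  define s where "s v = (\<Sum>e\<in>P. v (Some e))" for v :: "'e option \<Rightarrow> real"
  \<comment> \<open>This is the sum of the squared totals of \<open>v\<close> over the parallel
    classes; nonparallel pairs contribute the square of \<open>s v\<close> minus it.\<close>
  define r where "r v = (\<Sum>e\<in>P. v (Some e) * (\<Sum>f\<in>cls e. v (Some f)))" for v :: "'e option \<Rightarrow> real"
  have np: "(\<Sum>f\<in>{f\<in>P. \<not> par e f}. v (Some f)) = s v - (\<Sum>f\<in>cls e. v (Some f))" for e v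
  proof -
    have "s v = (\<Sum>f\<in>{f\<in>P. \<not> par e f} \<union> cls e. v (Some f))"
      unfolding s_def by (intro sum.cong) (auto simp: cls_def)
    also have "\<dots> = (\<Sum>f\<in>{f\<in>P. \<not> par e f}. v (Some f)) + (\<Sum>f\<in>cls e. v (Some f))"
      using finP by (intro sum.union_disjoint) (auto simp: cls_def)
    finally show ?thesis by simp
  qed
  have t0: "dirderiv N S [v] = fact (Suc (Suc n)) * v None + fact (Suc n) * s v" for v
  proof -
    have "dirderiv N S [v] = v None * fact (Suc (Suc n)) +
      (\<Sum>f\<in>P. v (Some f) * fact (N - card (insert f S)))"
      using finP by (simp add: stS sum.reindex step_def cS del: fact_Suc)
    also have "(\<Sum>f\<in>P. v (Some f) * fact (N - card (insert f S))) = (\<Sum>f\<in>P. fact (Suc n) * v (Some f))"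
      by (intro sum.cong refl) (simp only: cS1 mult.commute)
    finally show ?thesis by (simp add: s_def sum_distrib_left mult.commute del: fact_Suc)
  qed
  have Cons: "dirderiv N S [v, v'] = v None * dirderiv N S [v'] + (\<Sum>e\<in>P. v (Some e) * dirderiv N (insert e S) [v'])" for v v'
    unfolding dirderiv.simps(2)[of N S v] stS using finP
    by (simp add: sum.reindex step_def del: dirderiv.simps)
  have e0s: "s e0 = 0" "e0 None = 1" by (simp_all add: s_def e0_def)
  have q1: "dirderiv N S [v, e0] = fact (Suc (Suc n)) * v None + fact (Suc n) * s v" for v
  proof -
    have "dirderiv N S [v, e0] = dirderiv N S [e0, v]" by (rule dirderiv_swap)
    also have "\<dots> = dirderiv N S [v]"
      unfolding Cons by (simp add: e0_def del: dirderiv.simps)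
    finally show ?thesis by (simp only: t0)
  qed
  have q2: "dirderiv N S [v, v] = fact (Suc (Suc n)) * (v None)\<^sup>2 + 2 * fact (Suc n) * v None * s v
      + fact n * ((s v)\<^sup>2 - r v)" for v
  proof -
    have "(\<Sum>e\<in>P. v (Some e) * dirderiv N (insert e S) [v]) =
      (\<Sum>e\<in>P. fact (Suc n) * v None * v (Some e) + fact n * s v * v (Some e)
         - fact n * (v (Some e) * (\<Sum>f\<in>cls e. v (Some f))))"
      by (intro sum.cong refl) (simp add: t1 np algebra_simps del: fact_Suc dirderiv.simps)
    also have "\<dots> = fact (Suc n) * v None * s v + fact n * s v * s v - fact n * r v"
      by (simp add: sum.distrib sum_subtractf sum_distrib_left[symmetric] s_def r_def del: fact_Suc)
    finally show ?thesis unfolding Cons t0 by (simp add: power2_eq_square algebra_simps del: fact_Suc)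
  qed
  have cs: "(s v)\<^sup>2 \<le> real (Suc (Suc n)) * r v" for v
  proof -
    define b where "b y = (\<Sum>e\<in>{e\<in>P. cls e = y}. v (Some e))" for y
    have sb: "s v = (\<Sum>y\<in>cls ` P. b y)"
      unfolding s_def b_def by (rule sum.image_gen[OF finP])
    have "r v = (\<Sum>e\<in>P. v (Some e) * b (cls e))"
    proof -
      have "cls e = {f\<in>P. cls f = cls e}" if "e \<in> P" for e
      proof -
        have "{f\<in>P. cls f = cls e} = {f\<in>P. par f e}" using that cls_eq by blast
        then show ?thesis unfolding cls_def[of e] using par_sym by blast
      qed
      then show ?thesis unfolding r_def b_def by (intro sum.cong refl) simp
    qed
    also have "\<dots> = (\<Sum>y\<in>cls ` P. \<Sum>e\<in>{e\<in>P. cls e = y}. v (Some e) * b (cls e))"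
      by (rule sum.image_gen[OF finP])
    also have "\<dots> = (\<Sum>y\<in>cls ` P. (b y)\<^sup>2)"
    proof (intro sum.cong refl)
      fix y
      have "(\<Sum>e\<in>{e\<in>P. cls e = y}. v (Some e) * b (cls e)) = (\<Sum>e\<in>{e\<in>P. cls e = y}. v (Some e) * b y)"
        by (intro sum.cong refl) simp
      then show "(\<Sum>e\<in>{e\<in>P. cls e = y}. v (Some e) * b (cls e)) = (b y)\<^sup>2"
        by (simp add: b_def sum_distrib_right power2_eq_square)
    qed
    finally have rb: "r v = (\<Sum>y\<in>cls ` P. (b y)\<^sup>2)" .
    have "card (cls ` P) \<le> card P" using finP by (rule card_image_le)
    also have "\<dots> \<le> card (V - S)" using finite_ground by (intro card_mono) (auto simp: P_def)
    also have "\<dots> = card V - card S"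
      by (rule card_Diff_subset[OF finite_indep[OF S] indep_subset_ground[OF S]])
    also have "\<dots> \<le> Suc (Suc n)" using N by (simp add: n_def)
    finally have card: "card (cls ` P) \<le> Suc (Suc n)" .
    have "(s v)\<^sup>2 \<le> real (card (cls ` P)) * r v"
      using sum_squared_le_sum_of_squares[of b "cls ` P"] finP unfolding sb rb by (simp add: mult.commute)
    also have "\<dots> \<le> real (Suc (Suc n)) * r v"
      using card by (intro mult_right_mono) (auto simp: rb intro: sum_nonneg)
    finally show ?thesis .
  qed
  have "dirderiv N S [v, v] * dirderiv N S [e0, e0] \<le> (dirderiv N S [v, e0])\<^sup>2" for v
  proof -
    define g :: real where "g = fact n"
    define m where "m = real n + 1"
    have f1: "fact (Suc n) = m * g" and f2: "fact (Suc (Suc n)) = (m + 1) * m * g"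
      by (simp_all add: g_def m_def algebra_simps)
    have "g > 0" "m > 0" by (simp_all add: g_def m_def)
    \<comment> \<open>Eliminating \<open>y\<close>: all terms with \<open>v None\<close> cancel in
      the discriminant.\<close>
    have "(dirderiv N S [v, e0])\<^sup>2 - dirderiv N S [v, v] * dirderiv N S [e0, e0]
        = m * g\<^sup>2 * ((m + 1) * r v - (s v)\<^sup>2)"
      unfolding q1 q2[of v] e0s f1 f2 g_def[symmetric] by (simp add: power2_eq_square algebra_simps)
    moreover have "(m + 1) * r v - (s v)\<^sup>2 \<ge> 0" using cs[of v] by (simp add: m_def algebra_simps)
    ultimately show ?thesis using \<open>m > 0\<close> by (smt (verit) mult_nonneg_nonneg zero_le_power2)
  qed
  moreover have "dirderiv N S [e0, e0] > 0" unfolding q1 e0s by simp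
  ultimately show ?thesis
    using reverse_Cauchy_Schwarz_transfer[where X = "steps S" and a = "hess N S []" and x = e0 and u = u and w = w] w
    by (simp add: bform_hess hess_sym del: dirderiv.simps)
qed

text \<open>Induction on \<open>vs\<close>. The derivative along \<open>v\<close> is the sum of the
  contractions by \<open>i\<close> with weights \<open>v i\<close>; their inequalities against
  \<open>v\<close> add up to hypothesis \<open>le\<close> of \<open>trickle_down\<close> with
  \<open>x = v\<close>. Its conclusion is the inequality against \<open>v\<close>, which transfers
  to \<open>w\<close>.\<close>

lemma hodge_riemann:
  assumes "indep S" "card S + length vs + 2 \<le> N" "card V \<le> N"
    and "\<forall>v\<in>set vs. \<forall>i. v i > 0" and "dirderiv N S (w # w # vs) \<ge> 0"
  shows "dirderiv N S (u # u # vs) * dirderiv N S (w # w # vs) \<le> (dirderiv N S (u # w # vs))\<^sup>2"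
  using assms
proof (induction vs arbitrary: S u w)
  case Nil
  then show ?case using hodge_riemann_quadratic by simp
next
  case (Cons v vs)
  let ?X = "steps S" and ?a = "hess N S (v # vs)"
  have vpos: "\<And>i. v i > 0" and vspos: "\<forall>v\<in>set vs. \<forall>i. v i > 0" using Cons.prems by auto
  have sym: "\<And>i j. i \<in> ?X \<Longrightarrow> j \<in> ?X \<Longrightarrow> ?a i j = ?a j i" by (rule hess_sym)
  have pos: "dirderiv N T (v # vs) > 0" for T using Cons.prems(4) by (rule dirderiv_pos)
  then have nonneg: "?a i j \<ge> 0" for i j
    by (simp add: hess_def less_imp_le del: dirderiv.simps)
  \<comment> \<open>Differentiating by \<open>y\<close> keeps every step available, so the row of
    \<open>None\<close> provides irreducibility.\<close>
  have hub: "?a None j > 0" if "j \<in> ?X" for j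
    using that pos by (simp add: hess_def step_def del: dirderiv.simps)
  have le: "bform ?X ?a u u \<le> (\<Sum>i\<in>?X. v i * ((\<Sum>j\<in>?X. ?a i j * u j)\<^sup>2 / (\<Sum>j\<in>?X. ?a i j * v j)))" for u
  proof -
    have "bform ?X ?a u u = dirderiv N S (u # u # v # vs)" by (rule bform_hess)
    also have "\<dots> = dirderiv N S (v # u # u # vs)"
      using dirderiv_move[of N S "[u, u]" v vs] by simp
    also have "\<dots> = (\<Sum>i\<in>?X. v i * dirderiv N (step S i) (u # u # vs))" by simp
    also have "\<dots> \<le> (\<Sum>i\<in>?X. v i * ((\<Sum>j\<in>?X. ?a i j * u j)\<^sup>2 / (\<Sum>j\<in>?X. ?a i j * v j)))"
    proof (intro sum_mono mult_left_mono)
      fix i assume i: "i \<in> ?X"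
      have pos: "dirderiv N (step S i) (v # v # vs) > 0"
        using Cons.prems(4) by (intro dirderiv_pos) auto
      have "card (step S i) + length vs + 2 \<le> N" using card_step_le[of S i] Cons.prems(2) by simp
      from Cons.IH[OF indep_step[OF Cons.prems(1) i] this Cons.prems(3) vspos, of v u] pos
      have "dirderiv N (step S i) (u # u # vs) \<le>
          (dirderiv N (step S i) (u # v # vs))\<^sup>2 / dirderiv N (step S i) (v # v # vs)"
        by (simp add: pos_le_divide_eq del: dirderiv.simps)
      then show "dirderiv N (step S i) (u # u # vs) \<le>
          (\<Sum>j\<in>?X. ?a i j * u j)\<^sup>2 / (\<Sum>j\<in>?X. ?a i j * v j)"
        by (simp only: sum_hess[OF i])
    qed (use vpos in \<open>auto intro: less_imp_le\<close>)
    finally show ?thesis .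
  qed
  have rcs: "bform ?X ?a u u * bform ?X ?a v v \<le> (bform ?X ?a u v)\<^sup>2" for u
    by (rule trickle_down(1)[OF finite_steps sym nonneg vpos None_in_steps hub le])
  have "bform ?X ?a v v > 0"
    by (rule trickle_down(2)[OF finite_steps sym nonneg vpos None_in_steps hub le])
  from reverse_Cauchy_Schwarz_transfer[OF sym this rcs, of w u] Cons.prems(5)
  show ?case unfolding bform_hess by blast
qed

lemma continuous_on_dirderiv_perturb:
  "continuous_on UNIV (\<lambda>\<epsilon>. dirderiv N S (us @ map (\<lambda>v i. v i + \<epsilon>) vs))"
proof -
  have *: "continuous_on UNIV (\<lambda>\<epsilon>. dirderiv N S (map (\<lambda>v i. v i + \<epsilon>) vs))" for S
    by (induction vs arbitrary: S) (auto intro!: continuous_intros)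
  show ?thesis by (induction us arbitrary: S) (auto intro!: continuous_intros *)
qed

text \<open>The substitution directions used later vanish in some coordinates. Adding
  \<open>\<epsilon>\<close> to every entry of \<open>vs\<close> makes them positive, and the
  inequality survives the limit from the right.\<close>

lemma hodge_riemann_nonneg:
  assumes "indep S" "card S + length vs + 2 \<le> N" "card V \<le> N"
    and nonneg: "\<forall>v\<in>set (w # vs). \<forall>i. v i \<ge> 0"
  shows "dirderiv N S (u # u # vs) * dirderiv N S (w # w # vs) \<le> (dirderiv N S (u # w # vs))\<^sup>2"
proof -
  define p where "p \<epsilon> = map (\<lambda>v i. v i + \<epsilon>) vs" for \<epsilon> :: real
  have p0: "p 0 = vs" by (simp add: p_def)
  have lim: "((\<lambda>\<epsilon>. dirderiv N S (a # b # p \<epsilon>)) \<longlongrightarrow> dirderiv N S (a # b # vs)) (at_right 0)" for a b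
  proof -
    have "continuous_on UNIV (\<lambda>\<epsilon>. dirderiv N S ([a, b] @ p \<epsilon>))"
      unfolding p_def by (rule continuous_on_dirderiv_perturb)
    then have "isCont (\<lambda>\<epsilon>. dirderiv N S ([a, b] @ p \<epsilon>)) 0"
      by (simp add: continuous_on_eq_continuous_at del: dirderiv.simps)
    then show ?thesis using p0 by (simp add: isCont_def filterlim_at_split del: dirderiv.simps)
  qed
  have ev: "eventually (\<lambda>\<epsilon>. dirderiv N S (u # u # p \<epsilon>) * dirderiv N S (w # w # p \<epsilon>)
      \<le> (dirderiv N S (u # w # p \<epsilon>))\<^sup>2) (at_right 0)"
    using eventually_at_right_less[of "0::real"]
  proof eventually_elim
    case (elim \<epsilon>)
    have "\<forall>v\<in>set (p \<epsilon>). \<forall>i. v i > 0"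
      using nonneg elim by (auto simp: p_def intro: add_nonneg_pos)
    moreover from this have "dirderiv N S (w # w # p \<epsilon>) \<ge> 0"
      using nonneg by (intro dirderiv_nonneg) (auto intro: less_imp_le)
    ultimately show ?case
      using assms(1-3) by (intro hodge_riemann) (auto simp: p_def)
  qed
  show ?thesis
    by (rule tendsto_le[OF trivial_limit_at_right_real tendsto_power[OF lim] tendsto_mult[OF lim lim] ev])
qed

end

section \<open>Ultra log-concavity of independent sets\<close>

text \<open>Tangent direction of a substitution in which one variable enters the coordinates of
  \<open>G\<close>, and the homogenising coordinate \<open>None\<close> with weight
  \<open>c\<close>: weight 1 for the variable \<open>y\<close>, 0 for the second one.\<close>

definition dir :: "real \<Rightarrow> 'e set \<Rightarrow> 'e option \<Rightarrow> real" where
  "dir c G i = (case i of None \<Rightarrow> c | Some e \<Rightarrow> of_bool (e \<in> G))"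

context matroid
begin

lemma finite_indep_sets: "finite {Y. P Y \<and> indep (S \<union> Y)}"
proof (rule finite_subset)
  show "{Y. P Y \<and> indep (S \<union> Y)} \<subseteq> Pow V" using indep_subset_ground by blast
qed (simp add: finite_ground)

text \<open>Each of the \<open>m\<close> slots picks either \<open>y\<close>, with weight
  \<open>c\<close>, or a new element of \<open>G\<close>. A set \<open>Y\<close> of picked elements
  arises by choosing its slots and ordering it, hence the binomial and the factorial.\<close>

lemma dirderiv_replicate_dir:
  assumes "indep S"
  shows "dirderiv N S (replicate m (dir c G) @ vs) =
    (\<Sum>Y | Y \<subseteq> G - S \<and> indep (S \<union> Y).
       fact (card Y) * real (m choose card Y) * c ^ (m - card Y) * dirderiv N (S \<union> Y) vs)"
  using assms
proof (induction m arbitrary: S)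
  case 0
  have "Y = {}" if "indep (S \<union> Y)" "card Y = 0" for Y
    using that finite_indep by (metis card_0_eq finite_Un)
  then have "(\<Sum>Y | Y \<subseteq> G - S \<and> indep (S \<union> Y).
       fact (card Y) * real (0 choose card Y) * c ^ (0 - card Y) * dirderiv N (S \<union> Y) vs)
    = (\<Sum>Y\<in>{{}}. fact (card Y) * real (0 choose card Y) * c ^ (0 - card Y) * dirderiv N (S \<union> Y) vs)"
    using 0 by (intro sum.mono_neutral_right finite_indep_sets) (auto simp: binomial_eq_0_iff)
  then show ?case by simp
next
  case (Suc m)
  define Ys where "Ys T = {Y. Y \<subseteq> G - T \<and> indep (T \<union> Y)}" for T
  define w where "w m j = fact j * real (m choose j) * c ^ (m - j)" for m j
  define P where "P = {e \<in> V - S. indep (insert e S)}"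
  define f where "f e = dirderiv N (insert e S) (replicate m (dir c G) @ vs)" for e
  have finP: "finite P" using finite_ground by (simp add: P_def)
  have finYs: "finite (Ys T)" for T unfolding Ys_def by (rule finite_indep_sets)
  have finY: "finite Y" if "Y \<in> Ys S" for Y
    using that finite_indep by (auto simp: Ys_def)
  have "dirderiv N S (replicate (Suc m) (dir c G) @ vs) =
      c * dirderiv N S (replicate m (dir c G) @ vs) + (\<Sum>e\<in>P. of_bool (e \<in> G) * f e)"
  proof -
    have "steps S = insert None (Some ` P)" by (simp add: steps_def P_def)
    then show ?thesis using finP by (simp add: sum.reindex dir_def[of c G None] dir_def[of c G "Some _"] step_def f_def)
  qed
  also have "(\<Sum>e\<in>P. of_bool (e \<in> G) * f e) = (\<Sum>e\<in>P \<inter> G. f e)"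
    using finP by (simp add: sum.inter_restrict if_distrib of_bool_def if_distribR cong: if_cong)
  also have "\<dots> = (\<Sum>e\<in>P \<inter> G. \<Sum>Z\<in>Ys (insert e S). w m (card Z) * dirderiv N (S \<union> insert e Z) vs)"
    unfolding f_def by (intro sum.cong refl) (auto simp: P_def Ys_def w_def Suc.IH intro!: sum.cong)
  also have "\<dots> = (\<Sum>(e, Z)\<in>(SIGMA e:P \<inter> G. Ys (insert e S)). w m (card Z) * dirderiv N (S \<union> insert e Z) vs)"
    using finP finYs by (intro sum.Sigma) auto
  \<comment> \<open>The first picked element \<open>e\<close> is split off from
    \<open>Y = insert e Z\<close>; each \<open>Y\<close> is reached once for each of its
    elements.\<close>
  also have "\<dots> = (\<Sum>(Y, e)\<in>(SIGMA Y:Ys S. Y). w m (card Y - 1) * dirderiv N (S \<union> Y) vs)"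
  proof (rule sum.reindex_bij_witness[where i = "\<lambda>(Y, e). (e, Y - {e})" and j = "\<lambda>(e, Z). (insert e Z, e)"])
    fix p assume "p \<in> (SIGMA e:P \<inter> G. Ys (insert e S))"
    then obtain e Z where p: "p = (e, Z)" "e \<in> P" "e \<in> G" "Z \<in> Ys (insert e S)" by blast
    then have e: "e \<notin> Z" and "indep (S \<union> insert e Z)" by (auto simp: Ys_def)
    then have fZ: "finite Z" using finite_indep by fastforce
    show "(case case p of (e, Z) \<Rightarrow> (insert e Z, e) of (Y, e) \<Rightarrow> (e, Y - {e})) = p"
      using p e by simp
    show "(case p of (e, Z) \<Rightarrow> (insert e Z, e)) \<in> (SIGMA Y:Ys S. Y)"
      using p by (auto simp: Ys_def P_def)
    show "(case case p of (e, Z) \<Rightarrow> (insert e Z, e) of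
         (Y, e) \<Rightarrow> w m (card Y - 1) * dirderiv N (S \<union> Y) vs) =
       (case p of (e, Z) \<Rightarrow> w m (card Z) * dirderiv N (S \<union> insert e Z) vs)"
      using p e fZ by simp
  next
    fix q assume "q \<in> (SIGMA Y:Ys S. Y)"
    then obtain Y e where q: "q = (Y, e)" "e \<in> Y" "Y \<subseteq> G - S" "indep (S \<union> Y)"
      by (auto simp: Ys_def)
    then have Y: "insert e Y = Y" by auto
    show "(case case q of (Y, e) \<Rightarrow> (e, Y - {e}) of (e, Z) \<Rightarrow> (insert e Z, e)) = q"
      using q Y by simp
    have "indep (insert e S)" using indep_mono[OF q(4)] q(2) by blast
    moreover have "e \<in> V" using indep_subset_ground[OF q(4)] q(2) by blast
    moreover have "insert e S \<union> (Y - {e}) = S \<union> Y" using q by auto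
    ultimately show "(case q of (Y, e) \<Rightarrow> (e, Y - {e})) \<in> (SIGMA e:P \<inter> G. Ys (insert e S))"
      using q by (auto simp: Ys_def P_def)
  qed
  also have "\<dots> = (\<Sum>Y\<in>Ys S. \<Sum>e\<in>Y. w m (card Y - 1) * dirderiv N (S \<union> Y) vs)"
    using finYs finY by (intro sum.Sigma[symmetric]) auto
  also have "\<dots> = (\<Sum>Y\<in>Ys S. real (card Y) * w m (card Y - 1) * dirderiv N (S \<union> Y) vs)"
    by (simp add: mult.assoc)
  also have "dirderiv N S (replicate m (dir c G) @ vs) = (\<Sum>Y\<in>Ys S. w m (card Y) * dirderiv N (S \<union> Y) vs)"
    unfolding Suc.IH[OF Suc.prems] Ys_def w_def ..
  also have "c * (\<Sum>Y\<in>Ys S. w m (card Y) * dirderiv N (S \<union> Y) vs) +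
      (\<Sum>Y\<in>Ys S. real (card Y) * w m (card Y - 1) * dirderiv N (S \<union> Y) vs)
    = (\<Sum>Y\<in>Ys S. (c * w m (card Y) + real (card Y) * w m (card Y - 1)) * dirderiv N (S \<union> Y) vs)"
    by (simp add: sum_distrib_left sum.distrib[symmetric] algebra_simps)
  also have "\<dots> = (\<Sum>Y\<in>Ys S. w (Suc m) (card Y) * dirderiv N (S \<union> Y) vs)"
  proof -
    \<comment> \<open>Pascal's rule; wherever \<open>j - 1\<close> or an exponent is truncated, the
      factor \<open>real j\<close> or the binomial is zero.\<close>
    have "c * w m j + real j * w m (j - 1) = w (Suc m) j" for j
    proof (cases j)
      case (Suc l)
      have "c * c ^ (m - Suc l) * real (m choose Suc l) = c ^ (m - l) * real (m choose Suc l)"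
        by (cases "Suc l \<le> m") (auto simp: Suc_diff_Suc[symmetric] power_Suc[symmetric] simp del: power_Suc)
      then have "c * w m j = fact j * c ^ (m - l) * real (m choose Suc l)"
        by (simp add: w_def Suc mult_ac)
      moreover have "real j * w m (j - 1) = fact j * c ^ (m - l) * real (m choose l)"
        by (simp add: w_def Suc)
      ultimately show ?thesis by (simp add: w_def Suc algebra_simps)
    qed (simp add: w_def)
    then show ?thesis by simp
  qed
  finally show ?case by (simp add: Ys_def w_def)
qed

text \<open>In the first \<open>k\<close> slots the weight 0 forbids \<open>y\<close>, so exactly
  \<open>k\<close> elements of \<open>G\<close> are picked. The other slots admit \<open>y\<close>,
  and for any \<open>Z\<close> picked there the arrangements times the factorial of the base case
  give \<open>fact (N - k)\<close>, so all independent sets count alike.\<close>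

lemma dirderiv_eq_count:
  assumes G: "G \<union> G' = V" "G \<inter> G' = {}" and k: "k \<le> N" and N: "card V \<le> N"
  shows "dirderiv N {} (replicate k (dir 0 G) @ replicate (N - k) (dir 1 G')) =
    fact k * fact (N - k) * real (card {W. indep W \<and> card (W \<inter> G) = k})"
proof -
  define Ys where "Ys = {Y. Y \<subseteq> G \<and> indep Y \<and> card Y = k}"
  define Zs where "Zs Y = {Z. Z \<subseteq> G' \<and> indep (Y \<union> Z)}" for Y
  have finYs: "finite Ys"
    using finite_indep_sets[of "\<lambda>Y. Y \<subseteq> G \<and> card Y = k" "{}"] by (simp add: Ys_def conj_ac)
  have finZs: "finite (Zs Y)" for Y unfolding Zs_def by (rule finite_indep_sets)
  have inner: "dirderiv N Y (replicate (N - k) (dir 1 G')) = fact (N - k) * real (card (Zs Y))"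
    if Y: "Y \<in> Ys" for Y
  proof -
    have "dirderiv N Y (replicate (N - k) (dir 1 G') @ []) =
       (\<Sum>Z | Z \<subseteq> G' - Y \<and> indep (Y \<union> Z). fact (card Z) * real (N - k choose card Z) *
          1 ^ (N - k - card Z) * dirderiv N (Y \<union> Z) [])"
      using Y by (intro dirderiv_replicate_dir) (auto simp: Ys_def)
    also have "{Z. Z \<subseteq> G' - Y \<and> indep (Y \<union> Z)} = Zs Y"
      using Y G(2) by (auto simp: Zs_def Ys_def)
    also have "(\<Sum>Z\<in>Zs Y. fact (card Z) * real (N - k choose card Z) *
          1 ^ (N - k - card Z) * dirderiv N (Y \<union> Z) []) = (\<Sum>Z\<in>Zs Y. fact (N - k))"
    proof (intro sum.cong refl)
      fix Z assume Z: "Z \<in> Zs Y"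
      have "finite (Y \<union> Z)" "Y \<union> Z \<subseteq> V" using Z finite_indep indep_subset_ground by (auto simp: Zs_def)
      moreover have "Y \<inter> Z = {}" using Y Z G(2) by (auto simp: Ys_def Zs_def)
      ultimately have c: "card (Y \<union> Z) = k + card Z" "card (Y \<union> Z) \<le> card V"
        using Y card_mono[OF finite_ground, of "Y \<union> Z"] by (auto simp: card_Un_disjoint Ys_def)
      then have le: "card Z \<le> N - k" using N by linarith
      have "fact (card Z) * fact (N - k - card Z) * (N - k choose card Z) = (fact (N - k) :: nat)"
        by (rule binomial_fact_lemma[OF le])
      then have "fact (card Z) * fact (N - k - card Z) * real (N - k choose card Z) = fact (N - k)"
        by (metis of_nat_fact of_nat_mult)
      then show "fact (card Z) * real (N - k choose card Z) *
          1 ^ (N - k - card Z) * dirderiv N (Y \<union> Z) [] = fact (N - k)"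
        by (simp add: c(1) mult_ac)
    qed
    finally show ?thesis by simp
  qed
  have "dirderiv N {} (replicate k (dir 0 G) @ replicate (N - k) (dir 1 G')) =
     (\<Sum>Y | Y \<subseteq> G - {} \<and> indep ({} \<union> Y). fact (card Y) * real (k choose card Y) * 0 ^ (k - card Y) *
        dirderiv N ({} \<union> Y) (replicate (N - k) (dir 1 G')))"
    by (rule dirderiv_replicate_dir[OF indep_empty])
  also have "\<dots> = (\<Sum>Y\<in>Ys. fact (card Y) * real (k choose card Y) * 0 ^ (k - card Y) *
        dirderiv N ({} \<union> Y) (replicate (N - k) (dir 1 G')))"
    by (rule sum.mono_neutral_right[OF finite_indep_sets]) (auto simp: Ys_def)
  also have "\<dots> = (\<Sum>Y\<in>Ys. fact k * fact (N - k) * real (card (Zs Y)))"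
    by (intro sum.cong refl) (simp add: inner, simp add: Ys_def)
  also have "\<dots> = fact k * fact (N - k) * real (\<Sum>Y\<in>Ys. card (Zs Y))"
    by (simp add: sum_distrib_left)
  also have "(\<Sum>Y\<in>Ys. card (Zs Y)) = card (Sigma Ys Zs)"
    using finYs finZs by (intro card_SigmaI[symmetric]) auto
  also have "card (Sigma Ys Zs) = card {W. indep W \<and> card (W \<inter> G) = k}"
  proof (rule bij_betw_same_card[OF bij_betw_byWitness[where f = "\<lambda>(Y, Z). Y \<union> Z" and f' = "\<lambda>W. (W \<inter> G, W \<inter> G')"]])
    show "\<forall>p\<in>Sigma Ys Zs. (\<lambda>W. (W \<inter> G, W \<inter> G')) (case p of (Y, Z) \<Rightarrow> Y \<union> Z) = p"
      using G(2) by (auto simp: Ys_def Zs_def)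
    have "W \<inter> G \<union> W \<inter> G' = W" if "indep W" for W
      using indep_subset_ground[OF that] G(1) by blast
    then show "\<forall>W\<in>{W. indep W \<and> card (W \<inter> G) = k}. (case (W \<inter> G, W \<inter> G') of (Y, Z) \<Rightarrow> Y \<union> Z) = W"
      and "(\<lambda>W. (W \<inter> G, W \<inter> G')) ` {W. indep W \<and> card (W \<inter> G) = k} \<subseteq> Sigma Ys Zs"
      by (auto simp: Ys_def Zs_def intro: indep_mono)
    have "(Y \<union> Z) \<inter> G = Y" if "Y \<in> Ys" "Z \<in> Zs Y" for Y Z
      using that G(2) by (auto simp: Ys_def Zs_def)
    then show "(\<lambda>(Y, Z). Y \<union> Z) ` Sigma Ys Zs \<subseteq> {W. indep W \<and> card (W \<inter> G) = k}"
      by (auto simp: Ys_def Zs_def)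
  qed
  finally show ?thesis .
qed

text \<open>This is the inequality for \<open>u = b\<close> and \<open>w = a\<close>, the remaining
  directions being \<open>k - 1\<close> copies of \<open>b\<close> and \<open>N - (k + 1)\<close>
  copies of \<open>a\<close>: the three derivatives are the normalised counts up to the common
  factor \<open>fact N\<close>.\<close>

theorem ultra_log_concave_indep_trace:
  assumes G: "G \<subseteq> V" and N: "card V \<le> N" and k: "k \<ge> 1"
  defines "J \<equiv> \<lambda>k. real (card {W. indep W \<and> card (W \<inter> G) = k})"
  shows "(J k)\<^sup>2 / (real (N choose k))\<^sup>2 \<ge>
    J (k - 1) / real (N choose (k - 1)) * (J (k + 1) / real (N choose (k + 1)))"
proof (cases "k + 1 \<le> N")
  case False
  \<comment> \<open>The last denominator is 0, and division by 0 yields 0.\<close>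
  then have z: "real (N choose (k + 1)) = 0" by (simp add: binomial_eq_0_iff)
  show ?thesis unfolding z by simp
next
  case True
  define b a where "b = dir 0 G" and "a = dir 1 (V - G)"
  define us where "us = replicate (k - 1) b"
  define vs where "vs = us @ replicate (N - (k + 1)) a"
  have q: "dirderiv N {} (replicate j b @ replicate (N - j) a) = fact N * (J j / real (N choose j))"
    if "j \<le> N" for j
  proof -
    have "dirderiv N {} (replicate j b @ replicate (N - j) a) = fact j * fact (N - j) * J j"
      unfolding a_def b_def J_def using that N G by (intro dirderiv_eq_count) auto
    moreover have "real (N choose j) = fact N / (fact j * fact (N - j))"
      using that by (rule binomial_fact)
    ultimately show ?thesis by simp
  qed
  have b1: "replicate k b = b # us" and b2: "replicate (k + 1) b = b # b # us"
    using k by (cases k; simp add: us_def)+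
  have a1: "replicate (N - k) a = a # replicate (N - (k + 1)) a"
    and a2: "replicate (N - (k - 1)) a = a # a # replicate (N - (k + 1)) a"
    using True k by (simp_all flip: replicate_Suc add: Suc_diff_Suc)
  have bb: "dirderiv N {} (b # b # vs) = fact N * (J (k + 1) / real (N choose (k + 1)))"
    using q[of "k + 1"] True unfolding b2 by (simp add: vs_def del: dirderiv.simps)
  have mv: "dirderiv N {} (b # us @ a # ws) = dirderiv N {} (b # a # us @ ws)"
    "dirderiv N {} (us @ a # a # ws) = dirderiv N {} (a # a # us @ ws)" for ws
  proof -
    show "dirderiv N {} (b # us @ a # ws) = dirderiv N {} (b # a # us @ ws)"
      by (rule dirderiv_Cons_cong) (rule dirderiv_move)
    have "dirderiv N {} (us @ a # a # ws) = dirderiv N {} (a # us @ a # ws)" by (rule dirderiv_move)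
    also have "\<dots> = dirderiv N {} (a # a # us @ ws)" by (rule dirderiv_Cons_cong) (rule dirderiv_move)
    finally show "dirderiv N {} (us @ a # a # ws) = dirderiv N {} (a # a # us @ ws)" .
  qed
  have ba: "dirderiv N {} (b # a # vs) = fact N * (J k / real (N choose k))"
    using q[of k] True unfolding b1 a1 by (simp add: vs_def mv(1) del: dirderiv.simps)
  have aa: "dirderiv N {} (a # a # vs) = fact N * (J (k - 1) / real (N choose (k - 1)))"
    using q[of "k - 1"] True unfolding a2 us_def[symmetric] by (simp add: vs_def mv(2) del: dirderiv.simps)
  have "dirderiv N {} (b # b # vs) * dirderiv N {} (a # a # vs) \<le> (dirderiv N {} (b # a # vs))\<^sup>2"
  proof (rule hodge_riemann_nonneg[OF indep_empty _ N])
    show "card {} + length vs + 2 \<le> N" using True k by (simp add: vs_def us_def)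
    have "a i \<ge> 0" "b i \<ge> 0" for i by (auto simp: a_def b_def dir_def split: option.split)
    then show "\<forall>v\<in>set (a # vs). \<forall>i. v i \<ge> 0" by (auto simp: vs_def us_def)
  qed
  then have "(fact N)\<^sup>2 * (J (k - 1) / real (N choose (k - 1)) * (J (k + 1) / real (N choose (k + 1))))
      \<le> (fact N)\<^sup>2 * ((J k)\<^sup>2 / (real (N choose k))\<^sup>2)"
    unfolding aa bb ba by (simp add: power2_eq_square mult_ac)
  then show ?thesis by (rule mult_left_le_imp_le) simp
qed

end

section \<open>Matroids from bases\<close>

text \<open>For augmentation, take bases \<open>B\<close> over \<open>S\<close> and
  \<open>B'\<close> over \<open>S'\<close> with the fewest elements of \<open>B'\<close> outside
  \<open>S' \<union> B\<close>. Minimality puts \<open>B' - B\<close> into \<open>S'\<close>; a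
  failing augmentation puts \<open>S' - S\<close> outside \<open>B\<close> and \<open>B - B'\<close>
  into \<open>S\<close>. Equal basis sizes then contradict \<open>card S < card S'\<close>.\<close>

lemma matroid_of_bases:
  assumes fin: "finite V" and sub: "\<And>B. B \<in> \<B> \<Longrightarrow> B \<subseteq> V" and ne: "\<B> \<noteq> {}"
    and card: "\<And>B. B \<in> \<B> \<Longrightarrow> card B = r"
    and exch: "\<And>B B' x. B \<in> \<B> \<Longrightarrow> B' \<in> \<B> \<Longrightarrow> x \<in> B - B' \<Longrightarrow> \<exists>y\<in>B' - B. insert y (B - {x}) \<in> \<B>"
  shows "matroid V (\<lambda>S. \<exists>B\<in>\<B>. S \<subseteq> B)"
proof
  fix S S' assume S: "\<exists>B\<in>\<B>. S \<subseteq> B" and S': "\<exists>B\<in>\<B>. S' \<subseteq> B" and less: "card S < card S'"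
  show "\<exists>e\<in>S' - S. \<exists>B\<in>\<B>. insert e S \<subseteq> B"
  proof (rule ccontr)
    assume no: "\<not> (\<exists>e\<in>S' - S. \<exists>B\<in>\<B>. insert e S \<subseteq> B)"
    define Q where "Q p \<longleftrightarrow> fst p \<in> \<B> \<and> snd p \<in> \<B> \<and> S \<subseteq> fst p \<and> S' \<subseteq> snd p" for p
    define m where "m p = card (snd p - (S' \<union> fst p))" for p :: "'a set \<times> 'a set"
    obtain B1 B2 where "Q (B1, B2)" using S S' by (auto simp: Q_def)
    then obtain p where p: "Q p" "\<And>p'. Q p' \<Longrightarrow> m p \<le> m p'"
      using ex_has_least_nat[of Q "(B1, B2)" m] by blast
    obtain B B' where "p = (B, B')" by (cases p)
    with p(1) have B: "B \<in> \<B>" "B' \<in> \<B>" "S \<subseteq> B" "S' \<subseteq> B'"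
      by (simp_all add: Q_def)
    have least: "card (B' - (S' \<union> B)) \<le> card (C - (S' \<union> B))" if "C \<in> \<B>" "S' \<subseteq> C" for C
      using p(2)[of "(B, C)"] that B \<open>p = (B, B')\<close> by (simp add: Q_def m_def)
    have finB: "finite B" "finite B'" using finite_subset[OF sub fin] B by simp_all
    have 1: "B' - B \<subseteq> S'"
    proof (rule ccontr)
      assume "\<not> B' - B \<subseteq> S'"
      then obtain x where x: "x \<in> B' - B" "x \<notin> S'" by blast
      from exch[OF B(2,1) x(1)] obtain y where y: "y \<in> B - B'" "insert y (B' - {x}) \<in> \<B>" by blast
      have "insert y (B' - {x}) - (S' \<union> B) = (B' - (S' \<union> B)) - {x}" using y(1) by blast
      moreover have "card ((B' - (S' \<union> B)) - {x}) < card (B' - (S' \<union> B))"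
        using x finB by (intro card_Diff1_less) simp_all
      moreover have "S' \<subseteq> insert y (B' - {x})" using B(4) x by blast
      ultimately show False using least[OF y(2)] by simp
    qed
    have 2: "S' - S \<subseteq> B' - B"
      using no B by blast
    have 3: "B - B' \<subseteq> S"
    proof
      fix x assume x: "x \<in> B - B'"
      from exch[OF B(1,2) x] obtain y where y: "y \<in> B' - B" "insert y (B - {x}) \<in> \<B>" by blast
      have "y \<in> S' - S" using y(1) 1 B(3) by blast
      with no y(2) have "\<not> insert y S \<subseteq> insert y (B - {x})" by blast
      then show "x \<in> S" using B(3) by blast
    qed
    have "card (S' - S) \<le> card (B' - B)" using 2 finB by (intro card_mono) auto
    also have "\<dots> \<le> card (B - B')" using card_le_sym_Diff[of B' B] finB card B by simp
    also have "\<dots> \<le> card (S - S')" using 3 B(3,4) finite_subset[OF B(3) finB(1)] by (intro card_mono) auto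
    also have "\<dots> < card (S' - S)"
      using card_less_sym_Diff less finite_subset[OF B(3) finB(1)] finite_subset[OF B(4) finB(2)] by blast
    finally show False by simp
  qed
next
  show "finite V" by (rule fin)
  show "\<exists>B\<in>\<B>. {} \<subseteq> B" using ne by blast
  show "S \<subseteq> V" if "\<exists>B\<in>\<B>. S \<subseteq> B" for S using that sub by blast
  show "\<exists>B\<in>\<B>. S' \<subseteq> B" if "\<exists>B\<in>\<B>. S \<subseteq> B" "S' \<subseteq> S" for S S' using that by blast
qed

text \<open>
  Among the bases that contain \<open>B \<inter> B'\<close> and \<open>y\<close>, one closest to \<open>B\<close> differs from it by a single exchange.
\<close>

lemma basis_exchange_dual:
  assumes fin: "\<And>B. B \<in> \<B> \<Longrightarrow> finite B" and card: "\<And>B. B \<in> \<B> \<Longrightarrow> card B = r"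
    and exch: "\<And>B B' x. B \<in> \<B> \<Longrightarrow> B' \<in> \<B> \<Longrightarrow> x \<in> B - B' \<Longrightarrow> \<exists>y\<in>B' - B. insert y (B - {x}) \<in> \<B>"
    and B: "B \<in> \<B>" "B' \<in> \<B>" "y \<in> B' - B"
  shows "\<exists>x\<in>B - B'. insert y (B - {x}) \<in> \<B>"
proof -
  define Q where "Q C \<longleftrightarrow> C \<in> \<B> \<and> B \<inter> B' \<subseteq> C \<and> y \<in> C" for C
  have "Q B'" using B by (simp add: Q_def)
  then obtain C where C: "Q C" and least: "\<And>C'. Q C' \<Longrightarrow> card (C - B) \<le> card (C' - B)"
    using ex_has_least_nat[of Q B' "\<lambda>C. card (C - B)"] by blast
  have C': "C \<in> \<B>" "B \<inter> B' \<subseteq> C" "y \<in> C" using C by (simp_all add: Q_def)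
  have finBC: "finite B" "finite C" using fin B(1) C'(1) by simp_all
  have CB: "C - B = {y}"
  proof (rule ccontr)
    assume "C - B \<noteq> {y}"
    then obtain x where x: "x \<in> C - B" "x \<noteq> y" using B(3) C'(3) by blast
    from exch[OF C'(1) B(1) x(1)] obtain z where z: "z \<in> B - C" "insert z (C - {x}) \<in> \<B>" by blast
    have "B \<inter> B' \<subseteq> insert z (C - {x})" "y \<in> insert z (C - {x})" using C' x by blast+
    with z(2) have "Q (insert z (C - {x}))" unfolding Q_def by blast
    then have "card (C - B) \<le> card (insert z (C - {x}) - B)" by (rule least)
    moreover have "insert z (C - {x}) - B = (C - B) - {x}" using z(1) by blast
    moreover have "card ((C - B) - {x}) < card (C - B)"
      using x(1) finBC by (intro card_Diff1_less) simp_all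
    ultimately show False by simp
  qed
  have "card (B - C) = card (C - B)"
    using card_le_sym_Diff[OF finBC] card_le_sym_Diff[OF finBC(2,1)] card[OF B(1)] card[OF C'(1)] by simp
  then have "card (B - C) = 1" using CB by simp
  then obtain x where x: "B - C = {x}" by (rule card_1_singletonE)
  have "C = insert y (B - {x})" using CB x by blast
  moreover have "x \<in> B - B'" using x C'(2) by blast
  ultimately show ?thesis using C'(1) by blast
qed

section \<open>The matroid of a bimatroid\<close>

context bimatroid
begin

section \<open>Shrinking regular minors, and regular rectangles in terms of minors\<close>

lemma minorD:
  assumes "(I, J) \<in> R"
  shows "I \<subseteq> E" "J \<subseteq> F" "card I = card J" "finite I" "finite J"
proof -
  have "(I, J) \<in> same_card_pairs E F" using assms minors_subset by blast
  then show "I \<subseteq> E" "J \<subseteq> F" "card I = card J" by (auto simp: same_card_pairs_def)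
  then show "finite I" "finite J" using finite_subset[OF _ finite_rows] finite_subset[OF _ finite_columns] by simp_all
qed

text \<open>Column exchange against the empty minor has no column to swap in, so it deletes a chosen
  column together with some row.\<close>

lemma minor_shrink_columns:
  assumes "(I, J) \<in> R" "T \<subseteq> J"
  shows "\<exists>I'\<subseteq>I. (I', T) \<in> R"
  using assms
proof (induction "card (J - T)" arbitrary: I J)
  case 0
  then have "J = T" using minorD(5)[OF 0(2)] by auto
  then show ?case using 0 by blast
next
  case (Suc n)
  then obtain j where j: "j \<in> J - T" by (metis card.empty ex_in_conv nat.distinct(1))
  then obtain i where "i \<in> I" and R: "(I - {i}, J - {j}) \<in> R"
    using column_exchange[OF Suc.prems(1) empty_minor, of j] by auto
  have "J - {j} - T = (J - T) - {j}" by auto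
  then have "n = card (J - {j} - T)"
    using j Suc.hyps(2) minorD(5)[OF Suc.prems(1)] by simp
  from Suc.hyps(1)[OF this R] show ?case using j Suc.prems(2) by blast
qed

text \<open>Row exchange prescribes an incoming row, so the minor is grown from the empty one
  towards \<open>(I, J)\<close>: while its rows lie in \<open>I\<close>, no swap is possible and a
  column of \<open>J\<close> is added.\<close>

lemma minor_shrink_rows:
  assumes "(I, J) \<in> R" "S \<subseteq> I"
  shows "\<exists>J'\<subseteq>J. (S, J') \<in> R"
proof -
  have "finite S" using finite_subset[OF assms(2) minorD(4)[OF assms(1)]] .
  then show ?thesis using assms(2)
  proof (induction S)
    case empty
    then show ?case using empty_minor by blast
  next
    case (insert i S)
    have "S \<subseteq> I" using insert.prems by blast
    from insert.IH[OF this] obtain J' where J': "J' \<subseteq> J" "(S, J') \<in> R" by blast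
    have i: "i \<in> I - S" and "S - I = {}" using insert.prems insert.hyps by blast+
    with row_exchange[OF J'(2) assms(1) i]
    obtain j where j: "j \<in> J - J'" "(S \<union> {i}, J' \<union> {j}) \<in> R" by blast
    then have "J' \<union> {j} \<subseteq> J" "(insert i S, J' \<union> {j}) \<in> R" using J'(1) by simp_all
    then show ?case by blast
  qed
qed

lemma relative_rank_eq_iff:
  assumes "S \<subseteq> E"
  shows "relative_rank R S T = d \<longleftrightarrow>
    (\<exists>I J. (I, J) \<in> R \<and> card I = d \<and> card J = d \<and> I \<subseteq> S \<and> J \<subseteq> T) \<and>
    (\<forall>I J. (I, J) \<in> R \<longrightarrow> I \<subseteq> S \<longrightarrow> J \<subseteq> T \<longrightarrow> card I \<le> d)"
proof -
  let ?D = "{d. \<exists>I J. (I, J) \<in> R \<and> card I = d \<and> card J = d \<and> I \<subseteq> S \<and> J \<subseteq> T}"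
  have finS: "finite S" using finite_subset[OF assms finite_rows] .
  have fin: "finite ?D"
    by (rule finite_subset[of _ "{..card S}"]) (auto intro: card_mono[OF finS])
  have "0 \<in> ?D" by (intro CollectI exI[of _ "{}"]) (simp add: empty_minor)
  then have ne: "?D \<noteq> {}" by blast
  have "relative_rank R S T = d \<longleftrightarrow> d \<in> ?D \<and> (\<forall>d'\<in>?D. d' \<le> d)"
    unfolding relative_rank_def by (rule Max_eq_iff[OF fin ne])
  also have "(\<forall>d'\<in>?D. d' \<le> d) \<longleftrightarrow> (\<forall>I J. (I, J) \<in> R \<longrightarrow> I \<subseteq> S \<longrightarrow> J \<subseteq> T \<longrightarrow> card I \<le> d)"
  proof (intro iffI allI impI ballI)
    fix I J assume "\<forall>d'\<in>?D. d' \<le> d" and IJ: "(I, J) \<in> R" "I \<subseteq> S" "J \<subseteq> T"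
    moreover have "card I \<in> ?D" using IJ minorD(3)[OF IJ(1)] by auto
    ultimately show "card I \<le> d" by blast
  qed blast
  finally show ?thesis by simp
qed

text \<open>A minor attaining rank \<open>card T\<close> inside \<open>T\<close> uses all columns of
  \<open>T\<close>.\<close>

lemma vertical_regular_iff:
  assumes "S \<subseteq> E" "T \<subseteq> F"
  shows "vertical_regular R S T \<longleftrightarrow> (\<exists>I\<subseteq>S. (I, T) \<in> R)"
proof -
  have fin: "finite S" "finite T" using finite_subset[OF assms(1) finite_rows] finite_subset[OF assms(2) finite_columns] by simp_all
  show ?thesis
  proof
    assume "vertical_regular R S T"
    then obtain I J where IJ: "(I, J) \<in> R" "card J = card T" "I \<subseteq> S" "J \<subseteq> T"
      unfolding vertical_regular_def relative_rank_eq_iff[OF assms(1)] by blast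
    then have "J = T" using fin card_subset_eq by blast
    then show "\<exists>I\<subseteq>S. (I, T) \<in> R" using IJ by blast
  next
    assume "\<exists>I\<subseteq>S. (I, T) \<in> R"
    then obtain I where I: "I \<subseteq> S" "(I, T) \<in> R" by blast
    have "card I' \<le> card T" if "(I', J') \<in> R" "J' \<subseteq> T" for I' J'
      using minorD(3)[OF that(1)] card_mono[OF fin(2) that(2)] by simp
    then show "vertical_regular R S T"
      unfolding vertical_regular_def relative_rank_eq_iff[OF assms(1)]
      using I minorD(3)[OF I(2)] card_mono[OF fin(1) I(1)] by auto
  qed
qed

lemma horizontal_regular_iff:
  assumes "S \<subseteq> E" "T \<subseteq> F"
  shows "horizontal_regular R S T \<longleftrightarrow> (\<exists>J\<subseteq>T. (S, J) \<in> R)"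
proof -
  have fin: "finite S" "finite T" using finite_subset[OF assms(1) finite_rows] finite_subset[OF assms(2) finite_columns] by simp_all
  show ?thesis
  proof
    assume "horizontal_regular R S T"
    then obtain I J where IJ: "(I, J) \<in> R" "card I = card S" "I \<subseteq> S" "J \<subseteq> T"
      unfolding horizontal_regular_def relative_rank_eq_iff[OF assms(1)] by blast
    then have "I = S" using fin card_subset_eq by blast
    then show "\<exists>J\<subseteq>T. (S, J) \<in> R" using IJ by blast
  next
    assume "\<exists>J\<subseteq>T. (S, J) \<in> R"
    then obtain J where J: "J \<subseteq> T" "(S, J) \<in> R" by blast
    have "card I' \<le> card S" if "I' \<subseteq> S" for I'
      using card_mono[OF fin(1) that] .
    then show "horizontal_regular R S T"
      unfolding horizontal_regular_def relative_rank_eq_iff[OF assms(1)]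
      using J minorD(3)[OF J(2)] card_mono[OF fin(2) J(1)] by auto
  qed
qed

text \<open>For a matrix these are the column bases after adjoining an identity block. Complementing
  the rows gives all of them \<open>card E\<close> elements and merges the row and column axioms
  into basis exchange.\<close>

definition bases :: "('a + 'b) set set" where
  "bases = {(E - I) <+> J | I J. (I, J) \<in> R}"

text \<open>An element leaving on the left is a row entering \<open>I\<close>, one leaving on the
  right a column leaving \<open>J\<close>; the two outcomes of each axiom decide on which side the
  new element lies.\<close>

lemma bases_exchange:
  assumes B: "B \<in> bases" "B' \<in> bases" and x: "x \<in> B - B'"
  shows "\<exists>y\<in>B' - B. insert y (B - {x}) \<in> bases"
proof -
  obtain I J I' J' where IJ: "(I, J) \<in> R" "(I', J') \<in> R"
    and eq: "B = (E - I) <+> J" "B' = (E - I') <+> J'"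
    using B by (auto simp: bases_def)
  note sub = minorD(1,2)[OF IJ(1)] minorD(1,2)[OF IJ(2)]
  show ?thesis
  proof (cases x)
    case (Inl i')
    then have i': "i' \<in> I' - I" "i' \<in> E" using x eq by auto
    from row_exchange[OF IJ i'(1)] show ?thesis
    proof (elim disjE bexE)
      fix i assume i: "i \<in> I - I'" "(swap I i i', J) \<in> R"
      have "insert (Inl i) (B - {x}) = (E - swap I i i') <+> J"
        using i i' sub unfolding eq Inl by (auto simp: swap_def)
      then have "insert (Inl i) (B - {x}) \<in> bases" using i(2) by (auto simp: bases_def)
      then show ?thesis using i sub by (intro bexI[of _ "Inl i"]) (auto simp: eq)
    next
      fix j' assume j': "j' \<in> J' - J" "(I \<union> {i'}, J \<union> {j'}) \<in> R"
      have "insert (Inr j') (B - {x}) = (E - (I \<union> {i'})) <+> (J \<union> {j'})"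
        using i' unfolding eq Inl by auto
      then have "insert (Inr j') (B - {x}) \<in> bases" using j'(2) unfolding bases_def by blast
      then show ?thesis using j' by (intro bexI[of _ "Inr j'"]) (auto simp: eq)
    qed
  next
    case (Inr j)
    then have j: "j \<in> J - J'" using x eq by auto
    from column_exchange[OF IJ j] show ?thesis
    proof (elim disjE bexE)
      fix j' assume j': "j' \<in> J' - J" "(I, swap J j j') \<in> R"
      have "insert (Inr j') (B - {x}) = (E - I) <+> swap J j j'"
        using j j' unfolding eq Inr by (auto simp: swap_def)
      then have "insert (Inr j') (B - {x}) \<in> bases" using j'(2) by (auto simp: bases_def)
      then show ?thesis using j' by (intro bexI[of _ "Inr j'"]) (auto simp: eq)
    next
      fix i assume i: "i \<in> I - I'" "(I - {i}, J - {j}) \<in> R"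
      have "insert (Inl i) (B - {x}) = (E - (I - {i})) <+> (J - {j})"
        using i sub unfolding eq Inr by auto
      then have "insert (Inl i) (B - {x}) \<in> bases" using i(2) unfolding bases_def by blast
      then show ?thesis using i sub by (intro bexI[of _ "Inl i"]) (auto simp: eq)
    qed
  qed
qed

lemma bases_subset: "B \<in> bases \<Longrightarrow> B \<subseteq> E <+> F"
  using minorD(1,2) by (fastforce simp: bases_def)

lemma card_bases:
  assumes "B \<in> bases"
  shows "card B = card E"
proof -
  obtain I J where IJ: "(I, J) \<in> R" "B = (E - I) <+> J" using assms by (auto simp: bases_def)
  note m = minorD[OF IJ(1)]
  have "card B = card (E - I) + card J" using m finite_rows IJ(2) by (simp add: card_Plus)
  also have "card (E - I) = card E - card I" using m by (intro card_Diff_subset)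
  finally show ?thesis using m card_mono[OF finite_rows m(1)] by simp
qed

lemma bases_nonempty: "bases \<noteq> {}"
  using empty_minor by (auto simp: bases_def)

lemma finite_ground_Plus: "finite (E <+> F)"
  using finite_rows finite_columns by (rule finite_Plus)

lemma matroid_bases: "matroid (E <+> F) (\<lambda>W. \<exists>B\<in>bases. W \<subseteq> B)"
  by (rule matroid_of_bases[OF finite_ground_Plus bases_subset bases_nonempty card_bases bases_exchange])

lemma matroid_dual_bases: "matroid (E <+> F) (\<lambda>W. \<exists>B\<in>(\<lambda>B. (E <+> F) - B) ` bases. W \<subseteq> B)"
proof (rule matroid_of_bases[OF finite_ground_Plus])
  let ?V = "E <+> F"
  fix B assume "B \<in> (\<lambda>B. ?V - B) ` bases"
  then obtain C where C: "B = ?V - C" "C \<in> bases" by blast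
  then show "B \<subseteq> ?V" by blast
  show "card B = card ?V - card E"
    using C card_bases[OF C(2)] card_Diff_subset[OF _ bases_subset[OF C(2)]]
      finite_subset[OF bases_subset[OF C(2)] finite_ground_Plus] by simp
  fix B' x assume "B' \<in> (\<lambda>B. ?V - B) ` bases" and x: "x \<in> B - B'"
  then obtain C' where C': "B' = ?V - C'" "C' \<in> bases" by blast
  \<comment> \<open>Removing \<open>x\<close> from a complement inserts it into the basis, which
    calls for the exchange with a prescribed incoming element.\<close>
  have "x \<in> C' - C" using x C C' by auto
  then obtain y where y: "y \<in> C - C'" "insert x (C - {y}) \<in> bases"
    using basis_exchange_dual[of bases "card E" C C' x] C(2) C'(2) card_bases bases_exchange
      finite_subset[OF bases_subset finite_ground_Plus] by blast
  have "insert y (B - {x}) = ?V - insert x (C - {y})"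
    using x y C bases_subset[OF C(2)] by auto
  then show "\<exists>y\<in>B' - B. insert y (B - {x}) \<in> (\<lambda>B. ?V - B) ` bases"
    using y C C' bases_subset[OF C(2)] by (intro bexI[of _ y]) auto
qed (use bases_nonempty in simp)

section \<open>Regular rectangles counted as independent sets\<close>

lemma Plus_injectD:
  assumes "A <+> T = A' <+> T'"
  shows "A = A' \<and> T = T'"
proof -
  have "Inl -` (A <+> T) = A" "Inr -` (A <+> T) = T" "Inl -` (A' <+> T') = A'" "Inr -` (A' <+> T') = T'"
    by auto
  then show ?thesis using assms by simp
qed

lemma Plus_parts: "W \<subseteq> E <+> F \<Longrightarrow> \<exists>A T. A \<subseteq> E \<and> T \<subseteq> F \<and> W = A <+> T"
  by (intro exI[of _ "{a. Inl a \<in> W}"] exI[of _ "{b. Inr b \<in> W}"]) auto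

text \<open>The set \<open>(E - S) <+> T\<close> lies in the basis of a minor \<open>(I, J)\<close>
  iff \<open>I \<subseteq> S\<close> and \<open>T \<subseteq> J\<close>; such a minor shrinks to the
  columns \<open>T\<close>.\<close>

lemma RR_vertical_eq:
  "RR_vertical E F R k = card {W. (\<exists>B\<in>bases. W \<subseteq> B) \<and> card (W \<inter> Inr ` F) = k}"
proof -
  have ind: "(\<exists>B\<in>bases. (E - S) <+> T \<subseteq> B) \<longleftrightarrow> vertical_regular R S T"
    if "S \<subseteq> E" "T \<subseteq> F" for S T
  proof -
    have "(\<exists>B\<in>bases. (E - S) <+> T \<subseteq> B) \<longleftrightarrow> (\<exists>I J. (I, J) \<in> R \<and> I \<subseteq> S \<and> T \<subseteq> J)"
      using that(1) minorD(1) by (fastforce simp: bases_def)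
    also have "\<dots> \<longleftrightarrow> (\<exists>I\<subseteq>S. (I, T) \<in> R)"
      using minor_shrink_columns by (meson order_refl order_trans)
    finally show ?thesis using vertical_regular_iff[OF that] by simp
  qed
  have c: "card (((E - S) <+> T) \<inter> Inr ` F) = card T" if "T \<subseteq> F" for S T
  proof -
    have "((E - S) <+> T) \<inter> Inr ` F = Inr ` T" using that by auto
    then show ?thesis by (simp add: card_image)
  qed
  let ?f = "\<lambda>(S, T). (E - S) <+> T"
  let ?L = "{(S, T). S \<subseteq> E \<and> T \<subseteq> F \<and> vertical_regular R S T \<and> card T = k}"
  have inj: "inj_on ?f ?L"
    by (rule inj_onI) (auto dest!: Plus_injectD)
  have "?f ` ?L = {W. (\<exists>B\<in>bases. W \<subseteq> B) \<and> card (W \<inter> Inr ` F) = k}" (is "_ = ?R")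
  proof (intro equalityI subsetI)
    fix W assume "W \<in> ?f ` ?L"
    then show "W \<in> ?R" using ind c by auto
  next
    fix W assume W: "W \<in> ?R"
    then have "W \<subseteq> E <+> F" using bases_subset by blast
    from Plus_parts[OF this] obtain A T where A: "A \<subseteq> E" "T \<subseteq> F" "W = A <+> T" by blast
    then have W': "W = (E - (E - A)) <+> T" by (simp add: double_diff)
    have *: "(E - A, T) \<in> ?L"
      using W ind[of "E - A" T] c[of T "E - A"] A unfolding W' by auto
    show "W \<in> ?f ` ?L" by (rule image_eqI[OF _ *]) (simp only: W' case_prod_conv)
  qed
  then show ?thesis unfolding RR_vertical_def using card_image[OF inj] by simp
qed

text \<open>The complement of the basis of \<open>(I, J)\<close> is \<open>I <+> (F - J)\<close>. It
  contains \<open>S <+> (F - T)\<close> iff \<open>S \<subseteq> I\<close> and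
  \<open>J \<subseteq> T\<close>; such a minor shrinks to the rows \<open>S\<close>.\<close>

lemma RR_horizontal_eq:
  "RR_horizontal E F R k =
    card {W. (\<exists>B\<in>(\<lambda>B. (E <+> F) - B) ` bases. W \<subseteq> B) \<and> card (W \<inter> Inl ` E) = k}"
proof -
  define ind where "ind W \<longleftrightarrow> (\<exists>B\<in>(\<lambda>B. (E <+> F) - B) ` bases. W \<subseteq> B)" for W
  have ind_iff: "ind (S <+> (F - T)) \<longleftrightarrow> horizontal_regular R S T"
    if "S \<subseteq> E" "T \<subseteq> F" for S T
  proof -
    have "ind (S <+> (F - T)) \<longleftrightarrow>
        (\<exists>I J. (I, J) \<in> R \<and> S <+> (F - T) \<subseteq> (E <+> F) - ((E - I) <+> J))"
      by (auto simp: ind_def bases_def)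
    also have "\<dots> \<longleftrightarrow> (\<exists>I J. (I, J) \<in> R \<and> S \<subseteq> I \<and> J \<subseteq> T)"
    proof -
      have "S <+> (F - T) \<subseteq> (E <+> F) - ((E - I) <+> J) \<longleftrightarrow> S \<subseteq> I \<and> J \<subseteq> T" if "(I, J) \<in> R" for I J
        using minorD(2)[OF that] \<open>S \<subseteq> E\<close> by auto
      then show ?thesis by blast
    qed
    also have "\<dots> \<longleftrightarrow> (\<exists>J\<subseteq>T. (S, J) \<in> R)"
      using minor_shrink_rows by (meson order_refl order_trans)
    finally show ?thesis using horizontal_regular_iff[OF that] by simp
  qed
  have c: "card ((S <+> (F - T)) \<inter> Inl ` E) = card S" if "S \<subseteq> E" for S T
  proof -
    have "(S <+> (F - T)) \<inter> Inl ` E = Inl ` S" using that by auto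
    then show ?thesis by (simp add: card_image)
  qed
  let ?f = "\<lambda>(S, T). S <+> (F - T)"
  let ?L = "{(S, T). S \<subseteq> E \<and> T \<subseteq> F \<and> horizontal_regular R S T \<and> card S = k}"
  have inj: "inj_on ?f ?L"
    by (rule inj_onI) (auto dest!: Plus_injectD)
  have "?f ` ?L = {W. ind W \<and> card (W \<inter> Inl ` E) = k}" (is "_ = ?R")
  proof (intro equalityI subsetI)
    fix W assume "W \<in> ?f ` ?L"
    then obtain S T where W: "W = S <+> (F - T)"
      and ST: "S \<subseteq> E" "T \<subseteq> F" "horizontal_regular R S T" "card S = k"
      by (elim imageE CollectE case_prodE) simp
    show "W \<in> ?R" unfolding W using ind_iff[OF ST(1,2)] c[OF ST(1)] ST(3,4) by simp
  next
    fix W assume W: "W \<in> ?R"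
    then have "W \<subseteq> E <+> F" unfolding ind_def by blast
    from Plus_parts[OF this] obtain S A where A: "S \<subseteq> E" "A \<subseteq> F" "W = S <+> A" by blast
    then have W': "W = S <+> (F - (F - A))" by (simp add: double_diff)
    have *: "(S, F - A) \<in> ?L"
      using W ind_iff[OF A(1), of "F - A"] c[OF A(1), of "F - A"] A(1) unfolding W' by simp
    show "W \<in> ?f ` ?L" by (rule image_eqI[OF _ *]) (simp only: W' case_prod_conv)
  qed
  then show ?thesis unfolding RR_horizontal_def using card_image[OF inj] by (simp add: ind_def)
qed

end

theorem theoremB:
  fixes E :: "'a set" and F :: "'b set" and R :: "('a set \<times> 'b set) set" and N k :: nat
  assumes "bimatroid E F R"
    and "N = card E + card F"
    and "k \<ge> 1"
  shows "(real (RR_vertical E F R k))\<^sup>2 / (real (N choose k))\<^sup>2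
           \<ge> real (RR_vertical E F R (k - 1)) / real (N choose (k - 1))
             * (real (RR_vertical E F R (k + 1)) / real (N choose (k + 1)))
       \<and> (real (RR_horizontal E F R k))\<^sup>2 / (real (N choose k))\<^sup>2
           \<ge> real (RR_horizontal E F R (k - 1)) / real (N choose (k - 1))
             * (real (RR_horizontal E F R (k + 1)) / real (N choose (k + 1)))"
proof -
  interpret bimatroid E F R by fact
  have N: "card (E <+> F) \<le> N"
    using assms(2) finite_rows finite_columns by (simp add: card_Plus)
  \<comment> \<open>The two choices of the fixed set \<open>G\<close>: columns for vertical
    rectangles, and rows, in the dual matroid, for horizontal ones.\<close>
  have "Inr ` F \<subseteq> E <+> F" "Inl ` E \<subseteq> E <+> F" by auto
  then show ?thesis
    unfolding RR_vertical_eq RR_horizontal_eq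
    using matroid.ultra_log_concave_indep_trace[OF matroid_bases _ N assms(3)]
      matroid.ultra_log_concave_indep_trace[OF matroid_dual_bases _ N assms(3)] by blast
qed

end
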